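(* Let $X$ be a non-singular diffusion process started at $x$, with instantaneous variance $a$, and let $U_{\pm}(x,\lambda)$ and $\sigma_{\pm}(x,\cdot)$ be the associated Riccati variables and Stieltjes measures (defined in the context). Throughout, the choice of sign $+$ or $-$ is fixed; in expressions such as $\mp u_{n,\pm}$ the upper signs go together and the lower signs go together. (i) Suppose that $\sigma_{\pm}(x,\cdot)$ has infinitely many points of growth and that $$\int_{(0,\infty)} z^{-n}\,\sigma_{\pm}(x,\mathrm{d}z)<\infty \quad\text{for every positive integer } n .$$ Then there is a sequence of positive numbers $\mp u_{1,\pm}(x),\ \mp u_{2,\pm}(x),\ \ldots$ such that, for every $n=0,1,2,\ldots$, $$U_{\pm}(x,\lambda)-U_{\pm}(x,0)=\cfrac{2\lambda/a(x)}{u_{1,\pm}(x)+\cfrac{2\lambda/a(x)}{u_{2,\pm}(x)+\cdots+\cfrac{2\lambda/a(x)}{u_{n,\pm}(x)}}}+O(\lambda^{n+1})\quad\text{as }\lambda\to 0+$$ (for $n=0$ the finite continued fraction is $0$). (ii) Conversely, suppose that the identity $$U_{\pm}(x,\lambda)-U_{\pm}(x,0)=\cfrac{2\lambda/a(x)}{u_{1,\pm}(x)+\cfrac{2\lambda/a(x)}{u_{2,\pm}(x)+\cdots}}\qquad(\lambda>0)$$ holds for some infinite sequence $\mp u_{1,\pm}(x),\ \mp u_{2,\pm}(x),\ldots$ of positive numbers such that the series $\sum_{n=1}^\infty u_{n,\pm}(x)$ diverges. Then $\sigma_{\pm}(x,\cdot)$ has infinitely many points of growth and $\int_{(0,\infty)}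 z^{-n}\,\sigma_{\pm}(x,\mathrm{d}z)<\infty$ for every positive integer $n$.
   Context: Diffusion. $X$ is a one-dimensional diffusion on an interval $I$ with left endpoint $l$ and right endpoint $r$ ($-\infty\le l<r\le\infty$). In the interior of $I$ its infinitesimal generator is $$\mathscr{G}_W=\frac a2\,e^{-2W}\frac{\mathrm d}{\mathrm dx}\Big[e^{2W}\frac{\mathrm d}{\mathrm dx}\Big],\qquad W'=\frac ba,$$ where $a>0$ is the instantaneous variance and $b$ the instantaneous drift; $a,b$ are such that the scale function $s$, with $s'(x)=e^{-2W(x)}$, and the speed measure $m(\mathrm dx)=\frac2a e^{2W}\mathrm dx$ are well defined and finite on compact subintervals of $(l,r)$. $X$ is non-singular (regular): for all $x,y\in I$, the process started at $x$ hits $y$ in finite time with positive probability. Boundary behaviour. Fix $x_0\in(l,r)$. The endpoint $r$ is entrance if $\int_{x_0}^r[s(x)-s(x_0)]\,m(\mathrm dx)<\infty$ and exit if $\int_{x_0}^r m((x_0,x))\,s'(x)\,\mathrm dx<\infty$; it is non-singular if it is both. The same definitions are used at $l$, with the integrals $\int_l^{x_0}[s(x_0)-s(x)]\,m(\mathrm dx)$ and $\int_l^{x_0}m((x,x_0))\,s'(x)\,\mathrm dx$. Boundary conditions are imposed only at non-singular endpoints. If a non-singular endpoint is not in $I$, the process is killed there (functions vanish there). If a non-singular endpoint is in $I$, a Feller-type condition holds: at $r$, $\alpha_+\phi+\beta_+\phi'/s'+\gamma_+\lambda\phi=0$; at $l$, $\alpha_-\phi-\beta_-\phi'/s'+\gamma_-\lambda\phi=0$,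 where $\alpha_\pm\ge0$, $\beta_\pm>0$, $\gamma_\pm\ge0$, $\alpha_\pm+\beta_\pm+\gamma_\pm=1$. Riccati variables. For $\lambda>0$, the equation $\mathscr G_W\phi=\lambda\phi$ has, up to constant factors, a unique non-negative non-decreasing solution $\phi_-(\cdot,\lambda)$ satisfying the boundary condition (if any) at $l$, and a unique non-negative non-increasing solution $\phi_+(\cdot,\lambda)$ satisfying the boundary condition (if any) at $r$. With $H(y)=\inf\{t\ge0: X_t=y\}$, one has $\mathbb E_x(e^{-\lambda H(y)})=\phi_-(x,\lambda)/\phi_-(y,\lambda)$ if $x\le y$ and $=\phi_+(x,\lambda)/\phi_+(y,\lambda)$ if $x\ge y$. Define $$U_\pm(x,\lambda):=\frac{\phi_\pm'(x,\lambda)}{\phi_\pm(x,\lambda)}=\frac{\mathrm d}{\mathrm dy}\mathbb E_y\big(e^{-\lambda H(x)}\big)\Big|_{y=x\pm},\qquad U_\pm(x,0):=\lim_{\lambda\to0+}U_\pm(x,\lambda).$$ (If the starting point $x$ is an endpoint belonging to $I$, only the sign for which the one-sided derivative makes sense is considered, with $a(x)\in(0,\infty)$ and $U_\pm(x,\lambda)$ finite.) Thus $U_-\ge0$ and $U_+\le 0$. Stieltjes measures. By Krein's theory of strings (a known result), there is a unique measure $\sigma_\pm(x,\cdot)$ on $[0,\infty)$ with $\int_{[0,\infty)}\frac{\sigma_\pm(x,\mathrm dz)}{1+z}<\infty$ such that $$U_\pm(x,\lambda)=\mp2\lambda\int_{[0,\infty)}\frac{\sigma_\pm(x,\mathrm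 dz)}{\lambda+z},\qquad \lambda>0 ;$$ in particular $\sigma_\pm(x,\{0\})=\mp\frac12U_\pm(x,0)$. A measure has infinitely many points of growth if its support is an infinite set. *)

theory Defs
  imports "HOL-Probability.Probability" "HOL-Library.Landau_Symbols"
begin

datatype side = Plus | Minus

fun sg :: "side \<Rightarrow> real" where
  "sg Plus = 1"
| "sg Minus = -1"


section \<open>Coefficients, scale and speed\<close>

text \<open>
  The endpoint \<open>endpt D Plus\<close> is the right endpoint \<open>r\<close>, and \<open>endpt D Minus\<close> is the left
  endpoint \<open>l\<close>. The state space \<open>st\<close> is a set of extended reals, so that an infinite endpoint
  may or may not be a state. The coefficients \<open>bd_alpha\<close>, \<open>bd_beta\<close>, \<open>bd_gamma\<close> of the boundary
  conditions matter only at the non-singular endpoints that are states.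
\<close>

record diffusion_data =
  endpt :: "side \<Rightarrow> ereal"
  st :: "ereal set"
  avar :: "real \<Rightarrow> real"
  drift :: "real \<Rightarrow> real"
  pot :: "real \<Rightarrow> real"
  base :: real
  bd_alpha :: "side \<Rightarrow> real"
  bd_beta :: "side \<Rightarrow> real"
  bd_gamma :: "side \<Rightarrow> real"

definition inner_pts :: "diffusion_data \<Rightarrow> real set" where
  "inner_pts D = {x. endpt D Minus < ereal x \<and> ereal x < endpt D Plus}"

definition scale_dens :: "diffusion_data \<Rightarrow> real \<Rightarrow> real" where
  "scale_dens D x = exp (- 2 * pot D x)"

definition scale :: "diffusion_data \<Rightarrow> real \<Rightarrow> real" where
  "scale D x = (LBINT t=base D..x. scale_dens D t)"

definition speed :: "diffusion_data \<Rightarrow> real measure" where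
  "speed D = density lborel
     (\<lambda>x. indicator (inner_pts D) x * ennreal (2 / avar D x * exp (2 * pot D x)))"

fun entrance :: "diffusion_data \<Rightarrow> side \<Rightarrow> bool" where
  "entrance D Plus \<longleftrightarrow>
     (\<integral>\<^sup>+x\<in>{base D<..}. ennreal (scale D x - scale D (base D)) \<partial>speed D) < \<infinity>"
| "entrance D Minus \<longleftrightarrow>
     (\<integral>\<^sup>+x\<in>{..<base D}. ennreal (scale D (base D) - scale D x) \<partial>speed D) < \<infinity>"

fun exit :: "diffusion_data \<Rightarrow> side \<Rightarrow> bool" where
  "exit D Plus \<longleftrightarrow>
     (\<integral>\<^sup>+x\<in>inner_pts D \<inter> {base D<..}.
        emeasure (speed D) {base D<..<x} * ennreal (scale_dens D x) \<partial>lborel) < \<infinity>"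
| "exit D Minus \<longleftrightarrow>
     (\<integral>\<^sup>+x\<in>inner_pts D \<inter> {..<base D}.
        emeasure (speed D) {x<..<base D} * ennreal (scale_dens D x) \<partial>lborel) < \<infinity>"

definition nonsingular :: "diffusion_data \<Rightarrow> side \<Rightarrow> bool" where
  "nonsingular D p \<longleftrightarrow> entrance D p \<and> exit D p"

text \<open>
  The relation \<open>W' = b / a\<close> is read as: \<open>W\<close> is locally absolutely continuous with density \<open>b / a\<close>.
  In particular \<open>W\<close> is continuous, so the scale function is continuously differentiable.
\<close>

definition diffusion_coeffs :: "diffusion_data \<Rightarrow> bool" where
  "diffusion_coeffs D \<longleftrightarrow>
     endpt D Minus < endpt D Plus \<and>
     ereal ` inner_pts D \<subseteq> st D \<and>
     st D \<subseteq> ereal ` inner_pts D \<union> {endpt D Minus, endpt D Plus} \<and>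
     base D \<in> inner_pts D \<and>
     (\<forall>x\<in>inner_pts D. avar D x > 0) \<and>
     set_borel_measurable borel (inner_pts D) (avar D) \<and>
     set_borel_measurable borel (inner_pts D) (drift D) \<and>
     (\<forall>x\<in>inner_pts D. \<forall>y\<in>inner_pts D. x < y \<longrightarrow>
        set_integrable lborel {x..y} (\<lambda>u. drift D u / avar D u) \<and>
        pot D y - pot D x = (LINT u:{x..y}|lborel. drift D u / avar D u) \<and>
        set_integrable lborel {x..y} (scale_dens D) \<and>
        emeasure (speed D) {x..y} < \<infinity>) \<and>
     (\<forall>p. nonsingular D p \<and> endpt D p \<in> st D \<longrightarrow>
        bd_alpha D p \<ge> 0 \<and> bd_beta D p > 0 \<and> bd_gamma D p \<ge> 0 \<and>
        bd_alpha D p + bd_beta D p + bd_gamma D p = 1)"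


section \<open>Generator and boundary conditions\<close>

definition flux :: "diffusion_data \<Rightarrow> (ereal \<Rightarrow> real) \<Rightarrow> real \<Rightarrow> real" where
  "flux D f x = deriv (\<lambda>u. f (ereal u)) x / scale_dens D x"

text \<open>
  \<open>generates D f g\<close> states that \<open>g\<close> is the image of \<open>f\<close> under the generator
  \<open>(a/2) exp(-2W) d/dx [exp(2W) d/dx] = d/dm d/ds\<close> in the interior. The outer derivative is taken
  with respect to the speed measure, since \<open>a\<close> and \<open>b\<close> are only assumed measurable.
\<close>

definition generates :: "diffusion_data \<Rightarrow> (ereal \<Rightarrow> real) \<Rightarrow> (ereal \<Rightarrow> real) \<Rightarrow> bool" where
  "generates D f g \<longleftrightarrow>
     (\<forall>x\<in>inner_pts D. (\<lambda>u. f (ereal u)) differentiable (at x)) \<and>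
     (\<forall>x\<in>inner_pts D. \<forall>y\<in>inner_pts D. x < y \<longrightarrow>
        set_integrable (speed D) {x..y} (\<lambda>u. g (ereal u)) \<and>
        flux D f y - flux D f x = (LINT u:{x..y}|speed D. g (ereal u)))"

text \<open>Real arguments tending to a possibly infinite endpoint from inside the interval.\<close>

definition toward :: "diffusion_data \<Rightarrow> side \<Rightarrow> real filter" where
  "toward D p = filtercomap ereal (at (endpt D p) within ereal ` inner_pts D)"

text \<open>
  The function \<open>g\<close> stands for the image of \<open>f\<close> under the generator. It is \<open>\<lambda> f\<close> for an
  eigenfunction, which gives the term \<open>\<gamma> \<lambda> f\<close> of the Feller condition.
\<close>

definition boundary_cond ::
  "diffusion_data \<Rightarrow> side \<Rightarrow> (ereal \<Rightarrow> real) \<Rightarrow> (ereal \<Rightarrow> real) \<Rightarrow> bool" where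
  "boundary_cond D p f g \<longleftrightarrow>
     (nonsingular D p \<longrightarrow>
       (if endpt D p \<in> st D
        then \<exists>d. (flux D f \<longlongrightarrow> d) (toward D p) \<and>
               bd_alpha D p * f (endpt D p) + sg p * bd_beta D p * d
                 + bd_gamma D p * g (endpt D p) = 0
        else ((\<lambda>u. f (ereal u)) \<longlongrightarrow> 0) (toward D p)))"


section \<open>The process\<close>

text \<open>
  The process is a family of laws \<open>P y\<close>, one for each starting point \<open>y\<close>, on a common measurable
  space \<open>\<Omega>\<close>, with coordinates \<open>X t\<close> that are meaningful up to the lifetime \<open>\<zeta>\<close>.
\<close>

definition history ::
  "'w measure \<Rightarrow> (real \<Rightarrow> 'w \<Rightarrow> ereal) \<Rightarrow> ('w \<Rightarrow> ereal) \<Rightarrow> real \<Rightarrow> 'w set set" where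
  "history \<Omega> X \<zeta> s = sigma_sets (space \<Omega>)
     {{\<omega>\<in>space \<Omega>. ereal u < \<zeta> \<omega> \<and> X u \<omega> \<in> B} | u B. 0 \<le> u \<and> u \<le> s \<and> B \<in> sets borel}"

definition killed_markov_process ::
  "ereal set \<Rightarrow> 'w measure \<Rightarrow> (ereal \<Rightarrow> 'w measure) \<Rightarrow> (real \<Rightarrow> 'w \<Rightarrow> ereal) \<Rightarrow> ('w \<Rightarrow> ereal) \<Rightarrow> bool"
  where
  "killed_markov_process I \<Omega> P X \<zeta> \<longleftrightarrow>
     (\<forall>y\<in>I. prob_space (P y) \<and> sets (P y) = sets \<Omega>) \<and>
     (\<forall>E\<in>sets \<Omega>. (\<lambda>y. measure (P y) E) \<in> borel_measurable (restrict_space borel I)) \<and>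
     (\<forall>t\<ge>0. X t \<in> borel_measurable \<Omega>) \<and> \<zeta> \<in> borel_measurable \<Omega> \<and>
     (\<forall>\<omega>\<in>space \<Omega>. 0 < \<zeta> \<omega> \<and>
        (\<forall>t\<ge>0. ereal t < \<zeta> \<omega> \<longrightarrow> X t \<omega> \<in> I) \<and>
        continuous_on {t. 0 \<le> t \<and> ereal t < \<zeta> \<omega>} (\<lambda>t. X t \<omega>)) \<and>
     (\<forall>y\<in>I. measure (P y) {\<omega>\<in>space \<Omega>. X 0 \<omega> = y} = 1) \<and>
     (\<forall>y\<in>I. \<forall>s\<ge>0. \<forall>t\<ge>0. \<forall>A\<in>history \<Omega> X \<zeta> s. \<forall>B\<in>sets borel.
        measure (P y) (A \<inter> {\<omega>\<in>space \<Omega>. ereal (s + t) < \<zeta> \<omega> \<and> X (s + t) \<omega> \<in> B}) =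
        (LINT \<omega>:A|P y. (if ereal s < \<zeta> \<omega>
           then measure (P (X s \<omega>)) {\<omega>'\<in>space \<Omega>. ereal t < \<zeta> \<omega>' \<and> X t \<omega>' \<in> B}
           else 0)))"

definition transition ::
  "(ereal \<Rightarrow> 'w measure) \<Rightarrow> (real \<Rightarrow> 'w \<Rightarrow> ereal) \<Rightarrow> ('w \<Rightarrow> ereal) \<Rightarrow>
   real \<Rightarrow> (ereal \<Rightarrow> real) \<Rightarrow> ereal \<Rightarrow> real" where
  "transition P X \<zeta> t f y = (LINT \<omega>|P y. (if ereal t < \<zeta> \<omega> then f (X t \<omega>) else 0))"

text \<open>
  Functions are extended by \<open>0\<close> to the killed state. The last condition therefore makes \<open>f\<close>
  vanish at every endpoint outside the state space that is reached in finite time, singular or not.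
\<close>

definition generator_domain ::
  "diffusion_data \<Rightarrow> (ereal \<Rightarrow> real) \<Rightarrow> (ereal \<Rightarrow> real) \<Rightarrow> bool" where
  "generator_domain D f g \<longleftrightarrow>
     continuous_on (st D) f \<and> bounded (f ` st D) \<and>
     continuous_on (st D) g \<and> bounded (g ` st D) \<and>
     generates D f g \<and>
     (\<forall>p. boundary_cond D p f g) \<and>
     (\<forall>p. exit D p \<and> endpt D p \<notin> st D \<longrightarrow> ((\<lambda>u. f (ereal u)) \<longlongrightarrow> 0) (toward D p))"

text \<open>
  The generator is understood in the weak sense (bounded pointwise convergence of the difference
  quotients). Together with the Markov property it determines all the laws \<open>P y\<close>, and hence also the
  strong Markov property.
\<close>

definition regular_diffusion ::
  "diffusion_data \<Rightarrow> 'w measure \<Rightarrow> (ereal \<Rightarrow> 'w measure) \<Rightarrow> (real \<Rightarrow> 'w \<Rightarrow> ereal) \<Rightarrow>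
   ('w \<Rightarrow> ereal) \<Rightarrow> bool" where
  "regular_diffusion D \<Omega> P X \<zeta> \<longleftrightarrow>
     diffusion_coeffs D \<and>
     killed_markov_process (st D) \<Omega> P X \<zeta> \<and>
     (\<forall>f g. generator_domain D f g \<longrightarrow>
        (\<exists>C. \<forall>t>0. \<forall>y\<in>st D. \<bar>transition P X \<zeta> t f y - f y\<bar> \<le> C * t) \<and>
        (\<forall>y\<in>st D. ((\<lambda>t. (transition P X \<zeta> t f y - f y) / t) \<longlongrightarrow> g y) (at_right 0))) \<and>
     (\<forall>y\<in>st D. \<forall>z\<in>st D.
        measure (P y) {\<omega>\<in>space \<Omega>. \<exists>t\<ge>0. ereal t < \<zeta> \<omega> \<and> X t \<omega> = z} > 0)"


section \<open>Riccati variables and Stieltjes measures\<close>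

text \<open>
  \<open>monotone_eigenfunction D p lam \<phi>\<close> characterises \<open>\<phi>\<^sub>+(\<cdot>, lam)\<close> (for \<open>p = Plus\<close>: non-increasing,
  boundary condition at \<open>r\<close>) and \<open>\<phi>\<^sub>-(\<cdot>, lam)\<close> (for \<open>p = Minus\<close>: non-decreasing, boundary condition
  at \<open>l\<close>), each up to a positive factor.
\<close>

definition monotone_eigenfunction ::
  "diffusion_data \<Rightarrow> side \<Rightarrow> real \<Rightarrow> (ereal \<Rightarrow> real) \<Rightarrow> bool" where
  "monotone_eigenfunction D p lam \<phi> \<longleftrightarrow>
     continuous_on (st D) \<phi> \<and>
     (\<forall>y\<in>st D. \<phi> y \<ge> 0) \<and> (\<exists>y\<in>st D. \<phi> y \<noteq> 0) \<and>
     mono_on (st D) (\<lambda>y. - sg p * \<phi> y) \<and>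
     generates D \<phi> (\<lambda>y. lam * \<phi> y) \<and>
     boundary_cond D p \<phi> (\<lambda>y. lam * \<phi> y)"

fun one_sided :: "side \<Rightarrow> real \<Rightarrow> real filter" where
  "one_sided Plus x = at_right x"
| "one_sided Minus x = at_left x"

text \<open>
  If \<open>x\<close> is the endpoint \<open>r\<close> (respectively \<open>l\<close>), there is no right (respectively left) derivative at
  \<open>x\<close>, and the sign \<open>Plus\<close> (respectively \<open>Minus\<close>) is not considered. The differentiability
  assumption is a restriction only when \<open>x\<close> is an endpoint.
\<close>

definition riccati_admissible ::
  "diffusion_data \<Rightarrow> side \<Rightarrow> (real \<Rightarrow> ereal \<Rightarrow> real) \<Rightarrow> real \<Rightarrow> bool" where
  "riccati_admissible D p \<phi> x \<longleftrightarrow>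
     ereal x \<in> st D \<and> ereal x \<noteq> endpt D p \<and> avar D x > 0 \<and>
     (\<forall>lam>0. monotone_eigenfunction D p lam (\<phi> lam) \<and>
        (\<lambda>u. \<phi> lam (ereal u)) differentiable (one_sided p x))"

definition riccati :: "side \<Rightarrow> (real \<Rightarrow> ereal \<Rightarrow> real) \<Rightarrow> real \<Rightarrow> real \<Rightarrow> real" where
  "riccati p \<phi> x lam =
     vector_derivative (\<lambda>u. \<phi> lam (ereal u)) (one_sided p x) / \<phi> lam (ereal x)"

definition riccati0 :: "side \<Rightarrow> (real \<Rightarrow> ereal \<Rightarrow> real) \<Rightarrow> real \<Rightarrow> real" where
  "riccati0 p \<phi> x = Lim (at_right 0) (riccati p \<phi> x)"

definition stieltjes_measure :: "side \<Rightarrow> (real \<Rightarrow> real) \<Rightarrow> real measure \<Rightarrow> bool" where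
  "stieltjes_measure p U \<sigma> \<longleftrightarrow>
     sets \<sigma> = sets borel \<and> emeasure \<sigma> {..<0} = 0 \<and>
     (\<integral>\<^sup>+z\<in>{0..}. ennreal (1 / (1 + z)) \<partial>\<sigma>) < \<infinity> \<and>
     (\<forall>lam>0. U lam = - sg p * 2 * lam * (LINT z:{0..}|\<sigma>. 1 / (lam + z)))"

definition support :: "real measure \<Rightarrow> real set" where
  "support \<sigma> = {z. \<forall>e>0. emeasure \<sigma> (ball z e) > 0}"

definition all_inverse_moments_finite :: "real measure \<Rightarrow> bool" where
  "all_inverse_moments_finite \<sigma> \<longleftrightarrow>
     (\<forall>n\<ge>1. (\<integral>\<^sup>+z\<in>{0<..}. ennreal (1 / z ^ n) \<partial>\<sigma>) < \<infinity>)"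


section \<open>Continued fractions\<close>

text \<open>\<open>cfrac c [v\<^sub>1, \<dots>, v\<^sub>n] = c / (v\<^sub>1 + c / (v\<^sub>2 + \<dots> + c / v\<^sub>n))\<close>\<close>

fun cfrac :: "real \<Rightarrow> real list \<Rightarrow> real" where
  "cfrac c [] = 0"
| "cfrac c (v # vs) = c / (v + cfrac c vs)"

text \<open>Sequences of partial denominators are indexed from \<open>1\<close>; the value \<open>u 0\<close> is not used.\<close>

definition convergent_cf :: "real \<Rightarrow> (nat \<Rightarrow> real) \<Rightarrow> nat \<Rightarrow> real" where
  "convergent_cf c u n = cfrac c (map u [1..<Suc n])"

end

theory Submission
  imports Defs "HOL-Computational_Algebra.Formal_Power_Series"
begin

text \<open>
  Write \<open>U(\<lambda>) - U(0) = \<mp>2\<lambda> S(\<lambda>)\<close> with \<open>S(\<lambda>) = \<integral>\<^bsub>(0,\<infinity>)\<^esub> \<sigma>(dz) / (\<lambda> + z)\<close>. Put \<open>K = 2/a\<close>, \<open>M\<^sub>0 = a S\<close> and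
  \<open>1/M\<^sub>k = v\<^sub>k\<^sub>+\<^sub>1 + K \<lambda> M\<^sub>k\<^sub>+\<^sub>1\<close>; these are the tails of the continued fraction.

  (i) Finiteness of the inverse moments yields an asymptotic power series of \<open>S\<close> at \<open>0\<close>, and every
  \<open>M\<^sub>k\<close> inherits one when \<open>v\<^sub>k\<^sub>+\<^sub>1 = 1/M\<^sub>k(0)\<close>. Infinite support means that the moment functional is
  strictly positive. A Schur complement argument on polynomials shows that this positivity passes
  from \<open>M\<^sub>k\<close> to \<open>M\<^sub>k\<^sub>+\<^sub>1\<close>, hence all \<open>v\<^sub>k\<close> are positive.

  (ii) If the continued fraction converges to \<open>K \<lambda> M\<^sub>0\<close>, its tails converge to \<open>K \<lambda> M\<^sub>k\<close> with
  \<open>0 < M\<^sub>k \<le> 1/v\<^sub>k\<^sub>+\<^sub>1\<close>. Inserting these bounds repeatedly into \<open>M\<^sub>k = 1 / (v\<^sub>k\<^sub>+\<^sub>1 + K \<lambda> M\<^sub>k\<^sub>+\<^sub>1)\<close> gives \<open>M\<^sub>0\<close>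
  an asymptotic power series of every order, and monotone convergence turns its coefficients into
  inverse moments of \<open>\<sigma>\<close>. Finite support would make \<open>M\<^sub>0\<close> rational; but each tail of a rational
  function has smaller degree, so some \<open>M\<^sub>k\<close> would vanish.
\<close>

section \<open>Positive moment sequences\<close>

text \<open>The linear functional on polynomials that sends \<open>y^n\<close> to the
  \<open>n\<close>-th coefficient of \<open>A\<close>. Moment sequences are kept as formal power
  series so that a continued fraction step becomes a reciprocal followed by a shift.\<close>

definition mom :: "real fps \<Rightarrow> real poly \<Rightarrow> real" where
  "mom A p = (\<Sum>i\<le>degree p. coeff p i * fps_nth A i)"

lemma mom_bound: "degree p \<le> n \<Longrightarrow> mom A p = (\<Sum>i\<le>n. coeff p i * fps_nth A i)"
  unfolding mom_def by (rule sum.mono_neutral_left) (auto simp: coeff_eq_0 not_le)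

lemma mom_add: "mom A (p + q) = mom A p + mom A q"
proof -
  let ?n = "max (degree p) (degree q)"
  have "degree (p + q) \<le> ?n" "degree p \<le> ?n" "degree q \<le> ?n"
    by (auto intro: degree_add_le_max)
  then show ?thesis
    by (simp only: mom_bound[of _ ?n] coeff_add sum.distrib ring_distribs)
qed

lemma mom_smult: "mom A (smult c p) = c * mom A p"
proof -
  have "degree (smult c p) \<le> degree p" by simp
  then show ?thesis
    by (simp only: mom_bound[of _ "degree p"] coeff_smult sum_distrib_left mult.assoc)
qed

lemma mom_0 [simp]: "mom A 0 = 0"
  by (simp add: mom_def)

lemma mom_const [simp]: "mom A [:c:] = c * fps_nth A 0"
  by (simp add: mom_def)

lemma mom_minus: "mom A (- p) = - mom A p"
  using mom_smult[of A "-1" p] by simp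

lemma mom_diff: "mom A (p - q) = mom A p - mom A q"
  using mom_add[of A p "- q"] by (simp add: mom_minus)

lemma mom_monom: "mom A (monom c n) = c * fps_nth A n"
  by (subst mom_bound[of _ n]) (auto simp: degree_monom_le if_distrib[of "\<lambda>x. x * _"] cong: if_cong)

text \<open>
  The sequence \<open>A\<close> plays the role of \<open>\<integral> y\<^sup>n \<rho>(dy)\<close> for a measure \<open>\<rho>\<close> on the negative half-line
  (\<open>y = -1/z\<close>), so that no alternating signs occur in the expansion of its Stieltjes transform.
\<close>

definition positive_moments :: "real fps \<Rightarrow> bool" where
  "positive_moments A \<longleftrightarrow> (\<forall>p. p \<noteq> 0 \<longrightarrow> mom A (p * p) > 0 \<and> mom A (pCons 0 (p * p)) < 0)"

lemma positive_moments_nth_0: "positive_moments A \<Longrightarrow> fps_nth A 0 > 0"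
  unfolding positive_moments_def by (auto dest!: spec[of _ "1 :: real poly"] simp: one_pCons)

context
  fixes A :: "real fps"
  assumes pos: "positive_moments A"
begin

abbreviation (input) a0 :: real where "a0 \<equiv> fps_nth A 0"

text \<open>
  Multiplication by \<open>y\<close>, compressed to the orthogonal complement of the constants in
  \<open>L\<^sup>2(\<rho>)\<close>. The tail of the continued fraction has, up to a constant factor, the moments of this operator
  at the vector \<open>1\<close> with respect to the inner product \<open>energy\<close> of \<open>L\<^sup>2(-y \<rho>(dy))\<close>, which makes its positivity manifest.
\<close>

definition proj_shift :: "real poly \<Rightarrow> real poly" where
  "proj_shift p = pCons 0 p - [:mom A (pCons 0 p) / a0:]"

definition orbit :: "nat \<Rightarrow> real poly" where
  "orbit n = (proj_shift ^^ n) 1"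

text \<open>The polynomial \<open>p\<close> evaluated at the operator \<open>proj_shift\<close> and
  applied to the vector 1.\<close>

definition orbit_eval :: "real poly \<Rightarrow> real poly" where
  "orbit_eval p = (\<Sum>i\<le>degree p. smult (coeff p i) (orbit i))"

text \<open>Dividing by \<open>a0\<^sup>2\<close> makes the sequence exactly the shifted reciprocal
  of \<open>A\<close>.\<close>

definition tail_moments :: "real fps" where
  "tail_moments = Abs_fps (\<lambda>n. - mom A (pCons 0 (orbit n)) / a0\<^sup>2)"

definition energy :: "real poly \<Rightarrow> real poly \<Rightarrow> real" where
  "energy u w = - mom A (pCons 0 (u * w))"

lemma a0_pos: "a0 > 0"
  using positive_moments_nth_0[OF pos] .

lemma proj_shift_0: "proj_shift 0 = 0" by (simp add: proj_shift_def)

lemma proj_shift_add: "proj_shift (u + w) = proj_shift u + proj_shift w"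
proof -
  have "pCons 0 (u + w) = pCons 0 u + pCons 0 w" by simp
  then show ?thesis by (simp only: proj_shift_def mom_add add_divide_distrib) simp
qed

lemma proj_shift_smult: "proj_shift (smult c u) = smult c (proj_shift u)"
proof -
  have "pCons 0 (smult c u) = smult c (pCons 0 u)" by simp
  then show ?thesis by (simp add: proj_shift_def mom_smult smult_diff_right del: smult_pCons) simp
qed

lemma proj_shift_sum: "proj_shift (\<Sum>i\<in>I. f i) = (\<Sum>i\<in>I. proj_shift (f i))"
  by (induction I rule: infinite_finite_induct) (simp_all add: proj_shift_0 proj_shift_add)

text \<open>Self-adjointness: the left side expands to an expression symmetric in \<open>u\<close>
  and \<open>w\<close>, since the projection contributes only the product of
  \<open>mom A (pCons 0 u)\<close> and \<open>mom A (pCons 0 w)\<close>.\<close>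

lemma energy_proj_shift: "energy (proj_shift u) w = energy u (proj_shift w)"
proof -
  have *: "energy (proj_shift u) w = - mom A (pCons 0 (pCons 0 (u * w))) + mom A (pCons 0 u) * mom A (pCons 0 w) / a0"
    for u w
  proof -
    have "pCons 0 (proj_shift u * w) = pCons 0 (pCons 0 (u * w)) - smult (mom A (pCons 0 u) / a0) (pCons 0 w)"
      by (simp add: proj_shift_def left_diff_distrib)
    then show ?thesis by (simp only: energy_def mom_diff mom_smult) simp
  qed
  have "energy u (proj_shift w) = energy (proj_shift w) u" by (simp add: energy_def mult.commute)
  then show ?thesis by (simp only: *) (simp add: mult.commute)
qed

lemma energy_add: "energy (u + u') w = energy u w + energy u' w"
proof -
  have "pCons 0 ((u + u') * w) = pCons 0 (u * w) + pCons 0 (u' * w)" by (simp add: ring_distribs)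
  then show ?thesis by (simp only: energy_def mom_add minus_add_distrib)
qed

lemma energy_smult: "energy (smult c u) w = c * energy u w"
proof -
  have "pCons 0 (smult c u * w) = smult c (pCons 0 (u * w))" by simp
  then show ?thesis by (simp only: energy_def mom_smult mult_minus_right)
qed

lemma energy_sum: "energy (\<Sum>i\<in>I. f i) w = (\<Sum>i\<in>I. energy (f i) w)"
proof -
  have "energy 0 w = 0" by (simp add: energy_def)
  then show ?thesis by (induction I rule: infinite_finite_induct) (simp_all add: energy_add)
qed

text \<open>Horner's scheme for evaluation at \<open>proj_shift\<close>; it lets the following
  inductions run along \<open>pCons\<close>.\<close>

lemma orbit_eval_pCons: "orbit_eval (pCons c p) = [:c:] + proj_shift (orbit_eval p)"
proof (cases "p = 0")
  case True
  then show ?thesis by (simp add: orbit_eval_def orbit_def proj_shift_0)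
next
  case False
  then have "orbit_eval (pCons c p) = (\<Sum>i\<le>Suc (degree p). smult (coeff (pCons c p) i) (orbit i))"
    by (simp add: orbit_eval_def)
  also have "\<dots> = [:c:] + (\<Sum>i\<le>degree p. smult (coeff p i) (orbit (Suc i)))"
    by (subst sum.atMost_Suc_shift) (simp add: orbit_def)
  also have "(\<Sum>i\<le>degree p. smult (coeff p i) (orbit (Suc i))) = proj_shift (orbit_eval p)"
    by (simp add: orbit_eval_def proj_shift_sum proj_shift_smult orbit_def)
  finally show ?thesis .
qed

lemma orbit_eval_0: "orbit_eval 0 = 0" by (simp add: orbit_eval_def)

lemma orbit_eval_add: "orbit_eval (p + r) = orbit_eval p + orbit_eval r"
  by (induction p r rule: poly_induct2) (simp_all add: orbit_eval_0 orbit_eval_pCons proj_shift_add)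

lemma orbit_eval_smult: "orbit_eval (smult c p) = smult c (orbit_eval p)"
  by (induction p) (simp_all add: orbit_eval_0 orbit_eval_pCons proj_shift_smult smult_add_right)

text \<open>In each induction step self-adjointness moves one \<open>proj_shift\<close> to the right
  argument, where it multiplies \<open>r\<close> by the variable.\<close>

lemma energy_orbit_eval: "energy (orbit_eval p) (orbit_eval r) = energy (orbit_eval (p * r)) 1"
proof (induction p arbitrary: r)
  case 0
  then show ?case by (simp add: orbit_eval_0 energy_def)
next
  case (pCons c p)
  have "energy (orbit_eval (pCons c p)) (orbit_eval r) = c * energy 1 (orbit_eval r) + energy (orbit_eval p) (orbit_eval (pCons 0 r))"
    using energy_smult[of c 1 "orbit_eval r"] by (simp add: orbit_eval_pCons energy_add energy_proj_shift)
  also have "energy 1 (orbit_eval r) = energy (orbit_eval r) 1" by (simp add: energy_def)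
  also have "energy (orbit_eval p) (orbit_eval (pCons 0 r)) = energy (orbit_eval (pCons 0 (p * r))) 1"
    using pCons.IH[of "pCons 0 r"] by simp
  also have "c * energy (orbit_eval r) 1 + energy (orbit_eval (pCons 0 (p * r))) 1 = energy (orbit_eval (pCons c p * r)) 1"
    by (simp add: orbit_eval_add orbit_eval_smult energy_add energy_smult)
  finally show ?case .
qed

text \<open>A Horner step turns \<open>u\<close> into \<open>pCons 0 u\<close> with a changed
  constant coefficient, so a nonzero \<open>u\<close> stays nonzero.\<close>

lemma orbit_eval_nonzero: "p \<noteq> 0 \<Longrightarrow> orbit_eval p \<noteq> 0"
proof (induction p)
  case (pCons c p)
  then show ?case
    by (cases "p = 0") (auto simp: orbit_eval_pCons orbit_eval_0 proj_shift_0 proj_shift_def)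
qed simp

lemma mom_tail_moments: "mom tail_moments p = energy (orbit_eval p) 1 / a0\<^sup>2"
  by (simp add: mom_def[of tail_moments] orbit_eval_def energy_sum energy_smult sum_divide_distrib)
     (simp add: tail_moments_def energy_def)

text \<open>The two sign conditions exchange roles: the condition on \<open>pCons 0 (u * u)\<close>
  makes \<open>energy\<close> positive definite and gives the first sign for the tail, while the
  condition on \<open>w * w\<close> for the projected \<open>w\<close> gives the second.\<close>

lemma positive_moments_tail: "positive_moments tail_moments"
  unfolding positive_moments_def
proof (intro allI impI conjI)
  fix p :: "real poly" assume "p \<noteq> 0"
  define u where "u = orbit_eval p"
  have u: "u \<noteq> 0" using orbit_eval_nonzero[OF \<open>p \<noteq> 0\<close>] by (simp add: u_def)
  have "energy u u > 0" using pos u by (simp add: positive_moments_def energy_def)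
  moreover have "mom tail_moments (p * p) = energy u u / a0\<^sup>2" by (simp add: mom_tail_moments energy_orbit_eval u_def)
  ultimately show "mom tail_moments (p * p) > 0" using a0_pos by simp
  define w where "w = proj_shift u"
  have "w \<noteq> 0" using u by (auto simp: w_def proj_shift_def)
  then have "mom A (w * w) > 0" using pos by (simp add: positive_moments_def)
  \<comment> \<open>\<open>proj_shift\<close> removes the component along the constants, so the
    correction term of \<open>w * w\<close> below contributes nothing.\<close>
  have "mom A w = 0"
    using a0_pos by (simp only: w_def proj_shift_def mom_diff mom_const) simp
  have "w * w = pCons 0 (u * w) - smult (mom A (pCons 0 u) / a0) w"
    by (simp add: w_def proj_shift_def[of u] left_diff_distrib)
  then have "mom A (w * w) = - energy u w"
    using \<open>mom A w = 0\<close> by (simp add: mom_diff mom_smult energy_def)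
  moreover have "mom tail_moments (pCons 0 (p * p)) = energy u w / a0\<^sup>2"
  proof -
    have "energy u w = energy (orbit_eval p) (orbit_eval (pCons 0 p))" by (simp add: u_def w_def orbit_eval_pCons)
    then show ?thesis by (simp add: mom_tail_moments energy_orbit_eval)
  qed
  ultimately show "mom tail_moments (pCons 0 (p * p)) < 0"
    using \<open>mom A (w * w) > 0\<close> a0_pos by (simp add: divide_less_0_iff)
qed

text \<open>Each \<open>proj_shift\<close> multiplies by the variable and adds the constant
  \<open>a0 * fps_nth tail_moments n\<close>; unrolling this writes \<open>orbit n\<close> as a
  combination of powers.\<close>

lemma mom_orbit: "mom A (monom 1 k * orbit n) =
    fps_nth A (k + n) + a0 * (\<Sum>i<n. fps_nth tail_moments i * fps_nth A (k + n - Suc i))"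
proof (induction n arbitrary: k)
  case 0
  then show ?case by (simp add: orbit_def mom_monom)
next
  case (Suc n)
  have "orbit (Suc n) = pCons 0 (orbit n) + [:a0 * fps_nth tail_moments n:]"
    using a0_pos by (simp add: orbit_def proj_shift_def tail_moments_def power2_eq_square)
  then have "monom 1 k * orbit (Suc n) = monom 1 (Suc k) * orbit n + monom (a0 * fps_nth tail_moments n) k"
    by (simp add: monom_Suc ring_distribs smult_monom)
  then have "mom A (monom 1 k * orbit (Suc n))
      = mom A (monom 1 (Suc k) * orbit n) + a0 * fps_nth tail_moments n * fps_nth A k"
    by (simp only: mom_add mom_monom)
  then show ?case by (simp add: Suc.IH ring_distribs)
qed

lemma tail_moments_eq: "tail_moments = fps_shift 1 (inverse A)"
proof -
  \<comment> \<open>This is, up to the factor \<open>a0\<close>, the coefficient of index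
    \<open>n + 1\<close> in the product below. It comes from \<open>mom_orbit\<close> with
    \<open>k = 1\<close>, whose left side is by definition the missing summand
    \<open>i = n\<close>.\<close>
  have rec: "fps_nth A (Suc n) + a0 * (\<Sum>i\<le>n. fps_nth tail_moments i * fps_nth A (n - i)) = 0" for n
  proof -
    have "- a0\<^sup>2 * fps_nth tail_moments n = mom A (monom 1 1 * orbit n)"
      using a0_pos by (simp add: tail_moments_def monom_Suc)
    also have "\<dots> = fps_nth A (Suc n) + a0 * (\<Sum>i<n. fps_nth tail_moments i * fps_nth A (n - i))"
      by (subst mom_orbit) simp
    finally have "fps_nth A (Suc n) + a0 * (\<Sum>i<n. fps_nth tail_moments i * fps_nth A (n - i))
      + a0 * (fps_nth tail_moments n * a0) = 0" unfolding power2_eq_square by (simp add: algebra_simps)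
    then show ?thesis
      by (simp add: lessThan_Suc_atMost[symmetric] ring_distribs)
  qed
  have "(fps_const (1 / a0) + fps_X * tail_moments) * A = 1"
  proof (rule fps_ext)
    fix n
    show "fps_nth ((fps_const (1 / a0) + fps_X * tail_moments) * A) n = fps_nth 1 n"
    proof (cases n)
      case 0
      then show ?thesis using a0_pos by simp
    next
      case (Suc m)
      have "fps_nth (tail_moments * A) m = - fps_nth A (Suc m) / a0"
        using rec[of m] a0_pos
        unfolding fps_mult_nth by (simp add: field_simps atMost_atLeast0)
      then show ?thesis using Suc by (simp add: ring_distribs mult.assoc)
    qed
  qed
  then have "inverse A = fps_const (1 / a0) + fps_X * tail_moments"
    by (metis fps_inverse_unique mult.commute)
  then show ?thesis by (simp add: fps_eq_iff)
qed

end

lemma positive_moments_shift_inverse: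
  "positive_moments A \<Longrightarrow> positive_moments (fps_shift 1 (inverse A))"
  using positive_moments_tail[of A] tail_moments_eq[of A] by simp

lemma positive_moments_const_mult:
  assumes "positive_moments A" "c > 0"
  shows "positive_moments (fps_const c * A)"
proof -
  have "mom (fps_const c * A) p = c * mom A p" for p
    by (simp add: mom_def sum_distrib_left mult_ac)
  then show ?thesis
    using assms by (simp add: positive_moments_def mult_pos_neg)
qed

section \<open>Asymptotic expansions at zero\<close>

text \<open>
  \<open>expands N A f\<close> is \<open>f x = (\<Sum>n<N. A\<^sub>n x\<^sup>n) + O(x\<^sup>N)\<close> as \<open>x \<rightarrow> 0+\<close>, phrased with iterated divided differences;
  products and reciprocals can then be treated by induction on \<open>N\<close>.
\<close>

primrec expands :: "nat \<Rightarrow> real fps \<Rightarrow> (real \<Rightarrow> real) \<Rightarrow> bool" where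
  "expands 0 A f \<longleftrightarrow> f \<in> O[at_right 0](\<lambda>_. 1)"
| "expands (Suc N) A f \<longleftrightarrow> expands N (fps_shift 1 A) (\<lambda>x. (f x - fps_nth A 0) / x)"

lemma eventually_pos_at_right_0: "eventually (\<lambda>x::real. x > 0) (at_right 0)"
  by (simp add: eventually_at_right_less)

lemma expands_cong:
  assumes "eventually (\<lambda>x. f x = g x) (at_right 0)"
  shows "expands N A f \<longleftrightarrow> expands N A g"
  using assms
proof (induction N arbitrary: A f g)
  case 0
  then show ?case by (simp add: landau_o.big.in_cong)
next
  case (Suc N)
  from Suc.prems have "eventually (\<lambda>x. (f x - fps_nth A 0) / x = (g x - fps_nth A 0) / x) (at_right 0)"
    by eventually_elim simp
  then show ?case by (simp only: expands.simps) (rule Suc.IH)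
qed

lemma bigo_id_mult:
  assumes "(\<lambda>x. (f x - c) / x) \<in> O[at_right 0](\<lambda>_. 1 :: real)"
  shows "(\<lambda>x. f x - c) \<in> O[at_right 0](\<lambda>x. x)"
proof -
  have "(\<lambda>x. x * ((f x - c) / x)) \<in> O[at_right 0](\<lambda>x. x * 1)"
    by (intro landau_o.big.mult assms) simp
  moreover have "eventually (\<lambda>x. x * ((f x - c) / x) = f x - c) (at_right 0)"
    using eventually_pos_at_right_0 by eventually_elim simp
  ultimately show ?thesis by (simp add: landau_o.big.in_cong)
qed

lemma bigo_id_imp_tendsto:
  assumes "(\<lambda>x. f x - c) \<in> O[at_right (0::real)](\<lambda>x. x :: real)"
  shows "(f \<longlongrightarrow> c) (at_right 0)"
proof -
  have "(\<lambda>x::real. x) \<in> o[at_right 0](\<lambda>_. 1 :: real)"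
    by (rule smalloI_tendsto) (auto intro: tendsto_ident_at)
  then have "(\<lambda>x. f x - c) \<in> o[at_right 0](\<lambda>_. 1)"
    using assms landau_o.big_small_trans by blast
  then have "((\<lambda>x. f x - c) \<longlongrightarrow> 0) (at_right 0)"
    using smalloD_tendsto by fastforce
  then show ?thesis by (simp add: LIM_zero_iff)
qed

lemma tendsto_imp_bigo_1: "(f \<longlongrightarrow> (c::real)) F \<Longrightarrow> f \<in> O[F](\<lambda>_. 1 :: real)"
  by (rule bigoI_tendsto[where c = c]) auto

lemma expands_imp_bounded: "expands N A f \<Longrightarrow> f \<in> O[at_right 0](\<lambda>_. 1)"
proof (induction N arbitrary: A f)
  case (Suc N)
  then have "(\<lambda>x. (f x - fps_nth A 0) / x) \<in> O[at_right 0](\<lambda>_. 1)"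
    by simp
  from tendsto_imp_bigo_1[OF bigo_id_imp_tendsto[OF bigo_id_mult[OF this]]]
  show ?case .
qed simp

lemma expands_imp_tendsto:
  assumes "expands (Suc N) A f"
  shows "(f \<longlongrightarrow> fps_nth A 0) (at_right 0)"
  using assms by (auto intro!: bigo_id_imp_tendsto bigo_id_mult dest: expands_imp_bounded)

lemma expands_Suc_imp: "expands (Suc N) A f \<Longrightarrow> expands N A f"
proof (induction N arbitrary: A f)
  case 0
  then show ?case using expands_imp_bounded[OF 0] by simp
next
  case (Suc N)
  then show ?case by (metis expands.simps(2))
qed

lemma expands_add: "expands N A f \<Longrightarrow> expands N B g \<Longrightarrow> expands N (A + B) (\<lambda>x. f x + g x)"
proof (induction N arbitrary: A B f g)
  case 0
  then show ?case by (auto intro: sum_in_bigo)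
next
  case (Suc N)
  have "fps_shift 1 (A + B) = fps_shift 1 A + fps_shift 1 B" by (simp add: fps_eq_iff)
  with Suc.IH[OF Suc.prems[simplified]] show ?case
    by (simp add: diff_divide_distrib add_divide_distrib algebra_simps)
qed

lemma expands_0 [simp]: "expands N 0 (\<lambda>_. 0)"
  by (induction N) simp_all

lemma expands_const: "expands N (fps_const c) (\<lambda>_. c)"
proof (cases N)
  case (Suc M)
  have "fps_shift 1 (fps_const c) = (0 :: real fps)" by (simp add: fps_eq_iff)
  with Suc show ?thesis by simp
qed simp

text \<open>Splits \<open>f g - a b\<close> as \<open>a (g - b) + (f - a) g\<close>, and splits the
  shifted product series in the same way.\<close>

lemma expands_mult: "expands N A f \<Longrightarrow> expands N B g \<Longrightarrow> expands N (A * B) (\<lambda>x. f x * g x)"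
proof (induction N arbitrary: A B f g)
  case 0
  then show ?case by (auto dest: landau_o.big.mult)
next
  case (Suc N)
  let ?a = "fps_nth A 0" and ?b = "fps_nth B 0"
  let ?f = "\<lambda>x. (f x - ?a) / x" and ?g = "\<lambda>x. (g x - ?b) / x"
  have shift: "fps_shift 1 (A * B) = fps_const ?a * fps_shift 1 B + fps_shift 1 A * B"
    by (rule fps_ext) (simp add: fps_mult_nth sum.atLeast_Suc_atMost sum.atLeast_Suc_atMost_Suc_shift del: sum.cl_ivl_Suc)
  have "expands N (fps_const ?a * fps_shift 1 B + fps_shift 1 A * B) (\<lambda>x. ?a * ?g x + ?f x * g x)"
    using Suc.prems by (intro expands_add Suc.IH expands_const) (auto intro: expands_Suc_imp)
  moreover have "(\<lambda>x. ?a * ?g x + ?f x * g x) = (\<lambda>x. (f x * g x - ?a * ?b) / x)"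
    by (rule ext) (simp add: diff_divide_distrib algebra_simps)
  ultimately show ?case by (simp only: expands.simps(2) shift fps_mult_nth_0)
qed

lemma expands_id_mult:
  assumes "expands N A f"
  shows "expands (Suc N) (fps_X * A) (\<lambda>x. x * f x)"
proof -
  have "eventually (\<lambda>x. x * f x / x = f x) (at_right 0)"
    using eventually_pos_at_right_0 by eventually_elim simp
  moreover have "fps_shift 1 (fps_X * A) = A" by (rule fps_ext) simp
  ultimately show ?thesis using assms by (simp add: expands_cong del: times_divide_eq_left)
qed

text \<open>The formal version of \<open>(1/f - 1/a)/x = -(1/a) ((f - a)/x) (1/f)\<close>, where
  \<open>a\<close> is the value of \<open>f\<close> at 0.\<close>

lemma fps_shift_1_inverse:
  fixes A :: "'a :: field fps"
  assumes "fps_nth A 0 \<noteq> 0"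
  shows "fps_shift 1 (inverse A) = fps_const (- 1 / fps_nth A 0) * (fps_shift 1 A * inverse A)"
proof -
  have split: "C = fps_const (fps_nth C 0) + fps_X * fps_shift 1 C" for C :: "'a fps"
    by (rule fps_ext) simp
  let ?B = "inverse A" and ?a = "fps_nth A 0"
  have "A * ?B = 1" using assms by (simp add: inverse_mult_eq_1')
  then have "(fps_const ?a + fps_X * fps_shift 1 A) * ?B = 1" using split[of A] by simp
  then have "fps_X * (fps_shift 1 A * ?B) = 1 - fps_const ?a * ?B" by (simp add: algebra_simps)
  also have "fps_const ?a * ?B = fps_const ?a * (fps_const (1 / ?a) + fps_X * fps_shift 1 ?B)"
    using split[of ?B] by (simp add: inverse_eq_divide)
  also have "\<dots> = 1 + fps_const ?a * (fps_X * fps_shift 1 ?B)"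
    using assms by (simp add: distrib_left)
  also have "1 - \<dots> = fps_X * (- fps_const ?a * fps_shift 1 ?B)"
    by (simp add: fps_eq_iff)
  finally have "fps_shift 1 A * ?B = - fps_const ?a * fps_shift 1 ?B" by simp
  then show ?thesis using assms by (simp add: fps_eq_iff)
qed

text \<open>The divided difference of \<open>1 / f\<close> is a product of one of \<open>f\<close>
  and \<open>1 / f\<close> itself, the latter needed only to the lower order. The limit is a
  separate hypothesis because order 0 gives boundedness only.\<close>

lemma expands_inverse:
  assumes "expands N A f" "(f \<longlongrightarrow> fps_nth A 0) (at_right 0)" "fps_nth A 0 \<noteq> 0"
  shows "expands N (inverse A) (\<lambda>x. 1 / f x)"
  using assms(1)
proof (induction N)
  case 0
  have "((\<lambda>x. 1 / f x) \<longlongrightarrow> 1 / fps_nth A 0) (at_right 0)"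
    using assms by (intro tendsto_intros)
  then show ?case by (auto intro: tendsto_imp_bigo_1)
next
  case (Suc N)
  let ?a = "fps_nth A 0"
  have "expands N (fps_const (- 1 / ?a) * (fps_shift 1 A * inverse A))
     (\<lambda>x. (- 1 / ?a) * ((f x - ?a) / x * (1 / f x)))"
    using Suc.prems by (intro expands_mult expands_const Suc.IH[OF expands_Suc_imp]) auto
  moreover have ev: "eventually (\<lambda>x. (- 1 / ?a) * ((f x - ?a) / x * (1 / f x)) = (1 / f x - 1 / ?a) / x) (at_right 0)"
    using eventually_pos_at_right_0 tendsto_imp_eventually_ne[OF assms(2,3)]
    by eventually_elim (use assms(3) in \<open>simp add: field_simps\<close>)
  moreover have "fps_nth (inverse A) 0 = 1 / ?a" by (simp add: inverse_eq_divide)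
  ultimately show ?case
    by (simp only: expands.simps(2) fps_shift_1_inverse[OF assms(3)] expands_cong[OF ev])
qed

section \<open>Continued fractions\<close>

text \<open>Used with \<open>c\<close> equal to 1 or -1, to pass between the signed denominators of
  the theorem and positive ones.\<close>

lemma cfrac_scale:
  assumes "c * c = 1"
  shows "cfrac d (map (\<lambda>v. c * v) vs) = c * cfrac d vs"
proof (induction vs)
  case (Cons v vs)
  have "c \<noteq> 0" using assms by auto
  have "d / (c * v + c * cfrac d vs) = d / (c * (v + cfrac d vs))" by (simp add: algebra_simps)
  also have "\<dots> = c * c * d / (c * (v + cfrac d vs))" using assms by simp
  also have "\<dots> = c * (d / (v + cfrac d vs))" using \<open>c \<noteq> 0\<close> by simp
  finally show ?case using Cons by simp
qed simp

lemma convergent_cf_scale: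
  "c * c = 1 \<Longrightarrow> convergent_cf d (\<lambda>n. c * u n) n = c * convergent_cf d u n"
  unfolding convergent_cf_def using cfrac_scale[of c d "map u [1..<Suc n]"] by (simp add: comp_def)

lemma convergent_cf_0 [simp]: "convergent_cf d u 0 = 0"
  by (simp add: convergent_cf_def)

lemma convergent_cf_Suc: "convergent_cf d u (Suc n) = d / (u 1 + convergent_cf d (\<lambda>i. u (Suc i)) n)"
proof -
  have "map u [1..<Suc (Suc n)] = u 1 # map (\<lambda>i. u (Suc i)) [1..<Suc n]"
    by (simp add: upt_conv_Cons map_Suc_upt[symmetric] comp_def del: upt_Suc)
  then show ?thesis by (simp add: convergent_cf_def)
qed

lemma convergent_cf_nonneg:
  "d > 0 \<Longrightarrow> (\<And>i. i \<ge> 1 \<Longrightarrow> v i > 0) \<Longrightarrow> convergent_cf d v n \<ge> 0"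
proof (induction n arbitrary: v)
  case (Suc n)
  then show ?case by (simp add: convergent_cf_Suc add_nonneg_nonneg less_imp_le)
qed simp

text \<open>Here \<open>M k\<close> are exact tails. Replacing the tail \<open>K * x * M 1 x\<close>
  by its truncation \<open>g x\<close> multiplies the error of the truncation by
  \<open>- K * x * M 0 x / (v 1 + g x)\<close>, so every level gains one power of
  \<open>x\<close>.\<close>

lemma convergent_cf_error:
  assumes "K > 0" "\<And>i. i \<ge> 1 \<Longrightarrow> v i > 0"
    and "\<And>k. M k \<in> O[at_right 0](\<lambda>_. 1)"
    and "\<And>k. eventually (\<lambda>x. M k x * (v (Suc k) + K * x * M (Suc k) x) = 1) (at_right 0)"
  shows "(\<lambda>x. K * x * M 0 x - convergent_cf (K * x) v n) \<in> O[at_right 0](\<lambda>x. x ^ (n + 1))"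
  using assms(2-)
proof (induction n arbitrary: v M)
  case 0
  have "(\<lambda>x. (K * x) * M 0 x) \<in> O[at_right 0](\<lambda>x. x * 1)"
    by (intro landau_o.big.mult 0) simp
  then show ?case by simp
next
  case (Suc n)
  define g where "g x = convergent_cf (K * x) (\<lambda>i. v (Suc i)) n" for x
  have IH: "(\<lambda>x. K * x * M 1 x - g x) \<in> O[at_right 0](\<lambda>x. x ^ (n + 1))"
    unfolding g_def using Suc.IH[of "\<lambda>i. v (Suc i)" "\<lambda>i. M (Suc i)"] Suc.prems by simp
  have g: "g x \<ge> 0" if "x > 0" for x
    unfolding g_def using that \<open>K > 0\<close> Suc.prems(1) by (intro convergent_cf_nonneg) auto
  have v1: "v 1 > 0" using Suc.prems(1) by simp
  \<comment> \<open>Positivity of the denominators keeps \<open>v 1 + g x\<close> above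
    \<open>v 1\<close>.\<close>
  have bounded: "(\<lambda>x. - K * M 0 x / (v 1 + g x)) \<in> O[at_right 0](\<lambda>_. 1)"
  proof -
    have "eventually (\<lambda>x. norm (1 / (v 1 + g x)) \<le> 1 / v 1 * norm (1::real)) (at_right 0)"
      using eventually_pos_at_right_0
    proof eventually_elim
      case (elim x)
      then show ?case using v1 g[of x] by (simp add: frac_le)
    qed
    then have "(\<lambda>x. 1 / (v 1 + g x)) \<in> O[at_right 0](\<lambda>_. 1)" by (rule bigoI)
    with Suc.prems(2)[of 0] have "(\<lambda>x. - K * M 0 x * (1 / (v 1 + g x))) \<in> O[at_right 0](\<lambda>_. 1 * 1)"
      by (intro landau_o.big.mult) auto
    then show ?thesis by simp
  qed
  have "(\<lambda>x. x * ((K * x * M 1 x - g x) * (- K * M 0 x / (v 1 + g x)))) \<in> O[at_right 0](\<lambda>x. x * (x ^ (n + 1) * 1))"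
    by (intro landau_o.big.mult IH bounded) simp
  moreover have ev: "eventually (\<lambda>x. x * ((K * x * M 1 x - g x) * (- K * M 0 x / (v 1 + g x)))
      = K * x * M 0 x - convergent_cf (K * x) v (Suc n)) (at_right 0)"
    using eventually_pos_at_right_0 Suc.prems(3)[of 0]
  proof eventually_elim
    case (elim x)
    have nz: "v 1 + g x > 0" using v1 g[of x] elim by simp
    have "K * x * M 1 x * M 0 x = 1 - v 1 * M 0 x" using elim by (simp add: algebra_simps)
    then have "(K * x * M 1 x - g x) * M 0 x = 1 - (v 1 + g x) * M 0 x" by (simp add: algebra_simps)
    then have "x * ((K * x * M 1 x - g x) * (- K * M 0 x / (v 1 + g x)))
       = - K * x * (1 - (v 1 + g x) * M 0 x) / (v 1 + g x)" by (simp add: mult_ac)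
    also have "\<dots> = K * x * M 0 x - K * x / (v 1 + g x)"
      using nz by (simp add: field_simps)
    finally show ?case by (simp add: convergent_cf_Suc g_def)
  qed
  ultimately show ?case using landau_o.big.in_cong[OF ev] by simp
qed

section \<open>Infinite continued fractions and their tails\<close>

definition has_cf :: "real \<Rightarrow> (nat \<Rightarrow> real) \<Rightarrow> (real \<Rightarrow> real) \<Rightarrow> bool" where
  "has_cf K v M \<longleftrightarrow> (\<forall>n\<ge>1. v n > 0) \<and>
     (\<forall>x>0. (\<lambda>n. convergent_cf (K * x) v n) \<longlonglongrightarrow> K * x * M x)"

text \<open>Solves \<open>M x = 1 / (v 1 + K * x * M' x)\<close> for \<open>M' x\<close>.\<close>

definition cf_tail :: "real \<Rightarrow> (nat \<Rightarrow> real) \<Rightarrow> (real \<Rightarrow> real) \<Rightarrow> real \<Rightarrow> real" where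
  "cf_tail K v M x = (1 / M x - v 1) / (K * x)"

context
  fixes K :: real
  assumes K: "K > 0"
begin

text \<open>From index 2 on, all convergents lie between \<open>d / (v 1 + d / v 2)\<close> and
  \<open>d / v 1\<close>. The lower bound is positive and independent of the index, so it survives
  in the limit.\<close>

lemma has_cf_bounds:
  assumes "has_cf K v M" "x > 0"
  shows "0 < M x" "M x \<le> 1 / v 1"
proof -
  define d where "d = K * x"
  have d: "d > 0" using K assms by (simp add: d_def)
  have v: "v i > 0" if "i \<ge> 1" for i using assms that by (simp add: has_cf_def)
  have lim: "(\<lambda>n. convergent_cf d v (n + 2)) \<longlonglongrightarrow> d * M x"
    using assms unfolding has_cf_def d_def by (intro LIMSEQ_ignore_initial_segment) auto
  have nonneg: "convergent_cf d (\<lambda>i. v (Suc (Suc i))) n \<ge> 0"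
    "convergent_cf d (\<lambda>i. v (Suc i)) n \<ge> 0" for n
    using d v by (auto intro!: convergent_cf_nonneg)
  have v12: "v 1 > 0" "v (Suc 1) > 0" using v by auto
  have "convergent_cf d v (n + 2) \<le> d / v 1" for n
    using v12 nonneg(2)[of "Suc n"] d by (simp add: convergent_cf_Suc[of _ _ "Suc n"] frac_le)
  then have "d * M x \<le> d / v 1" using lim by (intro LIMSEQ_le_const2) auto
  then show "M x \<le> 1 / v 1" using d v12 by (simp add: field_simps)
  have "d / (v 1 + d / v (Suc 1)) \<le> convergent_cf d v (n + 2)" for n
  proof -
    have "d / (v (Suc 1) + convergent_cf d (\<lambda>i. v (Suc (Suc i))) n) \<le> d / v (Suc 1)"
      using nonneg(1)[of n] v12 d by (intro frac_le) auto
    moreover have "d / (v (Suc 1) + convergent_cf d (\<lambda>i. v (Suc (Suc i))) n) \<ge> 0"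
      using nonneg(1)[of n] v12 d by simp
    ultimately show ?thesis using v12 d
      by (simp add: convergent_cf_Suc) (intro frac_le; simp add: add_pos_nonneg)
  qed
  then have "d / (v 1 + d / v (Suc 1)) \<le> d * M x" using lim by (intro LIMSEQ_le_const) auto
  moreover have "0 < d / (v 1 + d / v (Suc 1))" using d v12 by (simp add: add_pos_pos)
  ultimately have "d * M x > 0" by linarith
  then show "M x > 0" using d by (simp add: zero_less_mult_iff)
qed

text \<open>The tail convergents are \<open>d / convergent_cf d v (Suc n) - v 1\<close>; strict
  positivity of \<open>M x\<close> permits the passage to the limit.\<close>

lemma has_cf_tail:
  assumes "has_cf K v M"
  shows "has_cf K (\<lambda>i. v (Suc i)) (cf_tail K v M)"
  unfolding has_cf_def
proof (intro conjI allI impI)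
  fix x :: real assume x: "x > 0"
  define d where "d = K * x"
  have d: "d > 0" using K x by (simp add: d_def)
  have v: "v i > 0" if "i \<ge> 1" for i using assms that by (simp add: has_cf_def)
  note M = has_cf_bounds(1)[OF assms x]
  have "(\<lambda>n. convergent_cf d v (Suc n)) \<longlonglongrightarrow> d * M x"
    using assms x unfolding has_cf_def d_def by (intro LIMSEQ_Suc) auto
  then have "(\<lambda>n. d / convergent_cf d v (Suc n) - v 1) \<longlonglongrightarrow> d / (d * M x) - v 1"
    using d M by (intro tendsto_intros) auto
  moreover have "d / convergent_cf d v (Suc n) - v 1 = convergent_cf d (\<lambda>i. v (Suc i)) n" for n
  proof -
    have "v 1 + convergent_cf d (\<lambda>i. v (Suc i)) n > 0"
      using v d by (intro add_pos_nonneg convergent_cf_nonneg) auto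
    then show ?thesis using d by (simp add: convergent_cf_Suc)
  qed
  ultimately show "(\<lambda>n. convergent_cf (K * x) (\<lambda>i. v (Suc i)) n) \<longlonglongrightarrow> K * x * cf_tail K v M x"
    using K x M by (simp add: cf_tail_def d_def)
qed (use assms in \<open>auto simp: has_cf_def\<close>)

lemma has_cf_eq:
  assumes "has_cf K v M" "x > 0"
  shows "M x = 1 / (v 1 + K * (x * cf_tail K v M x))"
  using has_cf_bounds[OF assms] assms(2) K by (simp add: cf_tail_def)

lemma has_cf_bounded:
  assumes "has_cf K v M"
  shows "M \<in> O[at_right 0](\<lambda>_. 1)"
proof (rule bigoI)
  show "eventually (\<lambda>x. norm (M x) \<le> 1 / v 1 * norm (1 :: real)) (at_right 0)"
    using eventually_pos_at_right_0
    by eventually_elim (use has_cf_bounds[OF assms] in \<open>auto simp: abs_of_pos\<close>)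
qed

text \<open>The tail enters multiplied by \<open>x\<close>, so expanding it to order
  \<open>N\<close> expands \<open>M\<close> to order \<open>N + 1\<close>; the base case is
  boundedness.\<close>

lemma has_cf_expands:
  assumes "has_cf K v M"
  shows "\<exists>A. expands N A M"
  using assms
proof (induction N arbitrary: v M)
  case 0
  then show ?case by (simp add: has_cf_bounded)
next
  case (Suc N)
  from Suc.IH[OF has_cf_tail[OF Suc.prems]] obtain C where "expands N C (cf_tail K v M)" ..
  define C' where "C' = fps_const (v 1) + fps_const K * (fps_X * C)"
  have *: "expands (Suc N) C' (\<lambda>x. v 1 + K * (x * cf_tail K v M x))"
    unfolding C'_def by (intro expands_add expands_mult expands_const expands_id_mult) fact
  have "fps_nth C' 0 \<noteq> 0" using Suc.prems by (auto simp: C'_def has_cf_def)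
  from expands_inverse[OF * expands_imp_tendsto[OF *] this]
  have "expands (Suc N) (inverse C') (\<lambda>x. 1 / (v 1 + K * (x * cf_tail K v M x)))" .
  moreover have ev: "eventually (\<lambda>x. M x = 1 / (v 1 + K * (x * cf_tail K v M x))) (at_right 0)"
    using eventually_pos_at_right_0 by eventually_elim (rule has_cf_eq[OF Suc.prems])
  ultimately show ?case using expands_cong[OF ev] by blast
qed

text \<open>Passing to the tail of the continued fraction of a rational function lowers the degree.\<close>

lemma has_cf_tail_rational:
  assumes cf: "has_cf K v M" and "Q \<noteq> 0" and eq: "\<And>x. x > 0 \<Longrightarrow> M x * poly Q x = poly P x"
  obtains P' where "\<And>x. x > 0 \<Longrightarrow> cf_tail K v M x * poly (smult K P) x = poly P' x"
    "smult K P \<noteq> 0" "P' \<noteq> 0" "Q - smult (v 1) P = pCons 0 P'"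
proof -
  \<comment> \<open>A nonzero polynomial has finitely many roots, so it cannot vanish on the whole
    positive half-line.\<close>
  have inf: "\<exists>x>0. poly R x \<noteq> 0" if "R \<noteq> 0" for R :: "real poly"
  proof (rule ccontr)
    assume "\<not> ?thesis"
    then have "{0<..} \<subseteq> {x. poly R x = 0}" by auto
    then show False using poly_roots_finite[OF that] infinite_Ioi finite_subset by blast
  qed
  have "P \<noteq> 0"
  proof
    assume "P = 0"
    then show False using inf[OF \<open>Q \<noteq> 0\<close>] eq has_cf_bounds(1)[OF cf] by fastforce
  qed
  define R where "R = Q - smult (v 1) P"
  have R: "poly R x = x * (cf_tail K v M x * poly (smult K P) x)" if "x > 0" for x
  proof -
    have "x * (cf_tail K v M x * poly (smult K P) x) = (x * K * cf_tail K v M x) * (M x * poly Q x)"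
      by (simp add: eq[OF that])
    also have "x * K * cf_tail K v M x = 1 / M x - v 1" using K that by (simp add: cf_tail_def)
    also have "\<dots> * (M x * poly Q x) = poly Q x - v 1 * (M x * poly Q x)"
      using has_cf_bounds(1)[OF cf that] by (simp add: left_diff_distrib)
    also have "\<dots> = poly R x" by (simp add: R_def eq[OF that])
    finally show ?thesis ..
  qed
  have "(poly R \<longlongrightarrow> poly R 0) (at_right 0)" by (intro tendsto_intros)
  \<comment> \<open>The tail is bounded near 0, so \<open>R\<close> is \<open>O(x)\<close>. Hence
    \<open>R\<close> vanishes at 0 and is divisible by the variable.\<close>
  moreover have "(poly R \<longlongrightarrow> 0) (at_right 0)"
  proof (rule bigo_id_imp_tendsto)
    have lim: "(poly (smult K P) \<longlongrightarrow> poly (smult K P) 0) (at_right 0)" by (intro tendsto_intros)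
    from landau_o.big.mult[OF has_cf_bounded[OF has_cf_tail[OF cf]] tendsto_imp_bigo_1[OF lim]]
    have "(\<lambda>x. cf_tail K v M x * poly (smult K P) x) \<in> O[at_right 0](\<lambda>_. 1)"
      by (simp only: mult_1)
    from landau_o.big.mult[OF landau_o.big_refl this]
    have "(\<lambda>x. x * (cf_tail K v M x * poly (smult K P) x)) \<in> O[at_right 0](\<lambda>x. x)"
      by (simp only: mult_1_right)
    moreover have ev: "eventually (\<lambda>x. x * (cf_tail K v M x * poly (smult K P) x) = poly R x - 0) (at_right 0)"
      using eventually_pos_at_right_0 by eventually_elim (simp only: R diff_0_right)
    ultimately show "(\<lambda>x. poly R x - 0) \<in> O[at_right 0](\<lambda>x. x)"
      using landau_o.big.in_cong[OF ev] by blast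
  qed
  ultimately have "poly R 0 = 0" by (intro tendsto_unique) auto
  then obtain P' where P': "R = pCons 0 P'" by (cases R) auto
  have eq': "cf_tail K v M x * poly (smult K P) x = poly P' x" if "x > 0" for x
    using R[OF that] that by (simp add: P')
  have "smult K P \<noteq> 0" using K \<open>P \<noteq> 0\<close> by simp
  have "P' \<noteq> 0"
  proof
    assume "P' = 0"
    then show False
      using inf[OF \<open>smult K P \<noteq> 0\<close>] eq' has_cf_bounds(1)[OF has_cf_tail[OF cf]] by fastforce
  qed
  show ?thesis
    by (rule that[OF eq' \<open>smult K P \<noteq> 0\<close> \<open>P' \<noteq> 0\<close>]) (simp_all add: P'[symmetric] R_def)
qed

text \<open>Infinite descent on a common degree bound \<open>r\<close> of numerator and denominator.
  One tail step lowers only the numerator bound, because the old numerator becomes the denominator;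
  two steps lower both.\<close>

lemma has_cf_not_rational:
  assumes "has_cf K v M" "Q \<noteq> 0" "\<And>x. x > 0 \<Longrightarrow> M x * poly Q x = poly P x"
  shows False
proof -
  have "False" if "degree P \<le> r" "degree Q \<le> r" "has_cf K v M" "Q \<noteq> 0"
    "\<And>x. x > 0 \<Longrightarrow> M x * poly Q x = poly P x" for r v M P Q
    using that
  proof (induction r arbitrary: v M P Q rule: less_induct)
    case (less r)
    obtain P1 where P1: "\<And>x. x > 0 \<Longrightarrow> cf_tail K v M x * poly (smult K P) x = poly P1 x"
      "smult K P \<noteq> 0" "P1 \<noteq> 0" "Q - smult (v 1) P = pCons 0 P1"
      using has_cf_tail_rational[OF less.prems(3-5)] by blast
    have "degree (pCons 0 P1) \<le> r" using less.prems(1,2)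
      by (simp add: P1(4)[symmetric] degree_diff_le)
    then have P1': "Suc (degree P1) \<le> r" using P1(3) by simp
    obtain P2 where P2: "\<And>x. x > 0 \<Longrightarrow>
        cf_tail K (\<lambda>i. v (Suc i)) (cf_tail K v M) x * poly (smult K P1) x = poly P2 x"
      "smult K P1 \<noteq> 0" "P2 \<noteq> 0" "smult K P - smult (v (Suc 1)) P1 = pCons 0 P2"
      using has_cf_tail_rational[OF has_cf_tail[OF less.prems(3)] P1(2,1)] by blast
    have "degree (pCons 0 P2) \<le> r" using less.prems(1) P1'
      by (simp only: P2(4)[symmetric]) (intro degree_diff_le; simp)
    then have P2': "Suc (degree P2) \<le> r" using P2(3) by simp
    have "r - 1 < r" "degree P2 \<le> r - 1" "degree (smult K P1) \<le> r - 1"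
      using P1' P2' by auto
    from less.IH[OF this has_cf_tail[OF has_cf_tail[OF less.prems(3)]] P2(2,1)] show False .
  qed
  from this[of P "max (degree P) (degree Q)" Q] assms show ?thesis by auto
qed

end

section \<open>Stieltjes transforms\<close>

definition inv_moment :: "real measure \<Rightarrow> nat \<Rightarrow> real" where
  "inv_moment \<mu> n = (\<integral>z. 1 / z ^ n \<partial>\<mu>)"

text \<open>The Stieltjes transform of the measure with density \<open>1 / z ^ n\<close> with
  respect to \<open>\<mu>\<close>.\<close>

definition resolvent :: "real measure \<Rightarrow> nat \<Rightarrow> real \<Rightarrow> real" where
  "resolvent \<mu> n x = (\<integral>z. 1 / (z ^ n * (x + z)) \<partial>\<mu>)"

section \<open>Inverse moments and Stieltjes transforms of measures on the positive
  half-line\<close>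

locale positive_support =
  fixes \<mu> :: "real measure"
  assumes sets_\<mu> [measurable_cong, simp]: "sets \<mu> = sets borel"
    and AE_pos: "AE z in \<mu>. 0 < z"
begin

lemma integrable_resolvent_Suc:
  assumes "integrable \<mu> (\<lambda>z. 1 / z ^ Suc n)" "x > 0"
  shows "integrable \<mu> (\<lambda>z. 1 / (z ^ n * (x + z)))" "integrable \<mu> (\<lambda>z. 1 / (z ^ Suc n * (x + z)))"
proof -
  show "integrable \<mu> (\<lambda>z. 1 / (z ^ n * (x + z)))"
    by (rule Bochner_Integration.integrable_bound[OF assms(1)])
       (use AE_pos assms(2) in \<open>auto elim!: eventually_mono simp: abs_of_pos intro!: frac_le mult_mono\<close>)
  show "integrable \<mu> (\<lambda>z. 1 / (z ^ Suc n * (x + z)))"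
    by (rule Bochner_Integration.integrable_bound[OF integrable_mult_left[OF assms(1), of "1 / x"]])
       (use AE_pos assms(2) in \<open>auto elim!: eventually_mono simp: abs_of_pos mult_ac intro!: frac_le mult_mono\<close>)
qed

text \<open>Integrates \<open>1/(z^n (x+z)) - 1/z^(n+1) = -x/(z^(n+1) (x+z))\<close>: the divided
  difference at 0 of one resolvent is minus the next.\<close>

lemma resolvent_Suc:
  assumes "integrable \<mu> (\<lambda>z. 1 / z ^ Suc n)" "x > 0"
  shows "(resolvent \<mu> n x - inv_moment \<mu> (Suc n)) / x = - resolvent \<mu> (Suc n) x"
proof -
  note I = integrable_resolvent_Suc[OF assms]
  have "resolvent \<mu> n x - inv_moment \<mu> (Suc n) = (\<integral>z. 1 / (z ^ n * (x + z)) - 1 / z ^ Suc n \<partial>\<mu>)"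
    unfolding resolvent_def inv_moment_def
    using I(1) assms(1) by (rule Bochner_Integration.integral_diff[symmetric])
  also have "\<dots> = (\<integral>z. - x * (1 / (z ^ Suc n * (x + z))) \<partial>\<mu>)"
  proof (rule integral_cong_AE)
    show "AE z in \<mu>. 1 / (z ^ n * (x + z)) - 1 / z ^ Suc n = - x * (1 / (z ^ Suc n * (x + z)))"
      using AE_pos
    proof eventually_elim
      case (elim z)
      have "x + z > 0" "z ^ n > 0" using elim assms(2) by auto
      then show ?case using elim by (simp add: divide_simps)
    qed
  qed measurable
  also have "\<dots> = - x * resolvent \<mu> (Suc n) x"
    unfolding resolvent_def by (rule integral_mult_right_zero)
  finally show ?thesis using assms(2) by simp
qed

lemma resolvent_nonneg: "x > 0 \<Longrightarrow> resolvent \<mu> n x \<ge> 0"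
  unfolding resolvent_def
  by (rule integral_nonneg_AE) (use AE_pos in \<open>auto elim!: eventually_mono\<close>)

lemma resolvent_bounded:
  assumes "integrable \<mu> (\<lambda>z. 1 / z ^ Suc n)"
  shows "resolvent \<mu> n \<in> O[at_right 0](\<lambda>_. 1)"
proof (rule bigoI)
  show "eventually (\<lambda>x. norm (resolvent \<mu> n x) \<le> inv_moment \<mu> (Suc n) * norm (1 :: real)) (at_right 0)"
    using eventually_pos_at_right_0
  proof eventually_elim
    case (elim x)
    have "(resolvent \<mu> n x - inv_moment \<mu> (Suc n)) / x \<le> 0"
      using resolvent_Suc[OF assms elim] resolvent_nonneg[OF elim] by simp
    then show ?case using elim resolvent_nonneg[OF elim, of n] by (simp add: divide_le_0_iff)
  qed
qed

lemma expands_resolvent: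
  assumes "\<And>k. integrable \<mu> (\<lambda>z. 1 / z ^ Suc k)"
  shows "expands N (Abs_fps (\<lambda>k. (- 1) ^ k * inv_moment \<mu> (Suc (n + k)))) (resolvent \<mu> n)"
proof (induction N arbitrary: n)
  case 0
  then show ?case using resolvent_bounded[OF assms] by simp
next
  case (Suc N)
  let ?A = "\<lambda>n. Abs_fps (\<lambda>k. (- 1) ^ k * inv_moment \<mu> (Suc (n + k)))"
  have "expands N (fps_const (- 1) * ?A (Suc n)) (\<lambda>x. - 1 * resolvent \<mu> (Suc n) x)"
    by (intro expands_mult expands_const Suc.IH)
  moreover have "fps_const (- 1) * ?A (Suc n) = fps_shift 1 (?A n)"
    by (rule fps_ext) simp
  moreover have "eventually (\<lambda>x. - 1 * resolvent \<mu> (Suc n) x = (resolvent \<mu> n x - fps_nth (?A n) 0) / x) (at_right 0)"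
    using eventually_pos_at_right_0
  proof eventually_elim
    case (elim x)
    show ?case using resolvent_Suc[OF assms elim, of n] by simp
  qed
  ultimately show ?case using expands_cong by (simp only: expands.simps)
qed

text \<open>One step of the converse: an expansion of order 1 provides a finite limit at 0, monotone
  convergence turns it into the inverse moment, and then \<open>resolvent_Suc\<close> passes the
  expansions on to the next resolvent.\<close>

lemma expands_resolvent_imp_integrable:
  assumes "\<And>N. \<exists>A. expands N A (resolvent \<mu> n)"
    and "\<And>x. x > 0 \<Longrightarrow> integrable \<mu> (\<lambda>z. 1 / (z ^ n * (x + z)))"
  shows "integrable \<mu> (\<lambda>z. 1 / z ^ Suc n)" "\<exists>A. expands N A (resolvent \<mu> (Suc n))"
proof -
  have *: "integrable \<mu> (\<lambda>z. 1 / z ^ Suc n)" "inv_moment \<mu> (Suc n) = c"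
    if "(resolvent \<mu> n \<longlongrightarrow> c) (at_right 0)" for c
  proof -
    \<comment> \<open>A sequence decreasing to 0, along which the integrands increase to
      \<open>1 / z ^ Suc n\<close>.\<close>
    let ?x = "\<lambda>k :: nat. inverse (real (Suc k))"
    have x: "filterlim ?x (at_right 0) sequentially"
      by (intro tendsto_imp_filterlim_at_right LIMSEQ_inverse_real_of_nat) simp
    have 1: "integrable \<mu> (\<lambda>z. 1 / (z ^ n * (?x k + z)))" for k
      by (rule assms(2)) simp
    have 2: "AE z in \<mu>. mono (\<lambda>k. 1 / (z ^ n * (?x k + z)))"
      using AE_pos
    proof eventually_elim
      case (elim z)
      show ?case
      proof (rule monoI)
        fix i j :: nat assume "i \<le> j"
        then have "?x j \<le> ?x i" by (simp add: field_simps)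
        moreover have "?x j > 0" by simp
        ultimately show "1 / (z ^ n * (?x i + z)) \<le> 1 / (z ^ n * (?x j + z))"
          using elim by (intro frac_le mult_left_mono mult_pos_pos add_pos_pos) auto
      qed
    qed
    have 3: "AE z in \<mu>. (\<lambda>k. 1 / (z ^ n * (?x k + z))) \<longlonglongrightarrow> 1 / z ^ Suc n"
      using AE_pos
    proof eventually_elim
      case (elim z)
      have "(\<lambda>k. 1 / (z ^ n * (?x k + z))) \<longlonglongrightarrow> 1 / (z ^ n * (0 + z))"
        using elim by (intro tendsto_intros LIMSEQ_inverse_real_of_nat) simp
      then show ?case by (simp add: mult.commute)
    qed
    have 4: "(\<lambda>k. \<integral>z. 1 / (z ^ n * (?x k + z)) \<partial>\<mu>) \<longlonglongrightarrow> c"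
      using filterlim_compose[OF that x] by (simp add: resolvent_def)
    have 5: "(\<lambda>z. 1 / z ^ Suc n) \<in> borel_measurable \<mu>" by measurable
    show "integrable \<mu> (\<lambda>z. 1 / z ^ Suc n)" "inv_moment \<mu> (Suc n) = c"
      using integrable_monotone_convergence[OF 1 2 3 4 5] integral_monotone_convergence[OF 1 2 3 4 5]
      by (simp_all add: inv_moment_def)
  qed
  from assms(1)[of "Suc 0"] obtain A0 where "expands (Suc 0) A0 (resolvent \<mu> n)" ..
  from *(1)[OF expands_imp_tendsto[OF this]] show int: "integrable \<mu> (\<lambda>z. 1 / z ^ Suc n)" .
  from assms(1)[of "Suc N"] obtain A where A: "expands (Suc N) A (resolvent \<mu> n)" ..
  \<comment> \<open>The divided difference of the expansion subtracts \<open>fps_nth A 0\<close>;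
    only because this is the inverse moment does \<open>resolvent_Suc\<close> apply.\<close>
  from *(2)[OF expands_imp_tendsto[OF this]] have c: "fps_nth A 0 = inv_moment \<mu> (Suc n)" by simp
  have ev: "eventually (\<lambda>x. resolvent \<mu> (Suc n) x = - 1 * ((resolvent \<mu> n x - fps_nth A 0) / x)) (at_right 0)"
    using eventually_pos_at_right_0 by eventually_elim (simp add: c resolvent_Suc[OF int])
  have "expands N (fps_const (- 1) * fps_shift 1 A) (\<lambda>x. - 1 * ((resolvent \<mu> n x - fps_nth A 0) / x))"
    using A by (intro expands_mult expands_const) simp
  then show "\<exists>A. expands N A (resolvent \<mu> (Suc n))" using expands_cong[OF ev] by blast
qed

lemma expands_imp_moments:
  assumes "\<And>N. \<exists>A. expands N A (resolvent \<mu> 0)"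
    and "\<And>x. x > 0 \<Longrightarrow> integrable \<mu> (\<lambda>z. 1 / (x + z))"
  shows "integrable \<mu> (\<lambda>z. 1 / z ^ Suc n)"
proof -
  \<comment> \<open>The first two conjuncts are the hypotheses of the single step and must be
    carried through the induction.\<close>
  have "(\<forall>N. \<exists>A. expands N A (resolvent \<mu> n)) \<and> (\<forall>x>0. integrable \<mu> (\<lambda>z. 1 / (z ^ n * (x + z)))) \<and>
     integrable \<mu> (\<lambda>z. 1 / z ^ Suc n)"
  proof (induction n)
    case 0
    then show ?case using assms expands_resolvent_imp_integrable(1)[of 0] by simp
  next
    case (Suc n)
    then have 1: "\<exists>A. expands N A (resolvent \<mu> (Suc n))" for N
      using expands_resolvent_imp_integrable(2)[of n] by blast
    have 2: "integrable \<mu> (\<lambda>z. 1 / (z ^ Suc n * (x + z)))" if "x > 0" for x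
      using Suc.IH integrable_resolvent_Suc(2)[of n x] that by blast
    show ?case using 1 2 expands_resolvent_imp_integrable(1)[of "Suc n"] by blast
  qed
  then show ?thesis by blast
qed

text \<open>The moment functional is integration against the image of \<open>\<mu>(dz)/z\<close>
  under \<open>y = -1/z\<close>.\<close>

lemma mom_inv_moment:
  assumes "\<And>k. integrable \<mu> (\<lambda>z. 1 / z ^ Suc k)"
  shows "mom (Abs_fps (\<lambda>k. (- 1) ^ k * inv_moment \<mu> (Suc k))) p = (\<integral>z. poly p (- 1 / z) / z \<partial>\<mu>)"
    and "integrable \<mu> (\<lambda>z. poly p (- 1 / z) / z)"
proof -
  have eq: "poly p (- 1 / z) / z = (\<Sum>i\<le>degree p. (coeff p i * (- 1) ^ i) * (1 / z ^ Suc i))" for z :: real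
    unfolding poly_altdef power_divide sum_divide_distrib by (simp add: mult_ac)
  show "integrable \<mu> (\<lambda>z. poly p (- 1 / z) / z)"
    unfolding eq by (intro Bochner_Integration.integrable_sum integrable_mult_right assms)
  show "mom (Abs_fps (\<lambda>k. (- 1) ^ k * inv_moment \<mu> (Suc k))) p = (\<integral>z. poly p (- 1 / z) / z \<partial>\<mu>)"
    unfolding eq
    by (subst Bochner_Integration.integral_sum[OF integrable_mult_right[OF assms]])
       (simp only: mom_def inv_moment_def integral_mult_right_zero fps_nth_Abs_fps mult.assoc)
qed

text \<open>If the integral of the square vanished, \<open>\<mu>\<close> would live on the finitely
  many points \<open>-1/y\<close> with \<open>y\<close> a root of \<open>p\<close>. The extra
  variable \<open>y = -1/z\<close> in the second condition supplies the negative sign.\<close>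

lemma positive_inv_moments:
  assumes int: "\<And>k. integrable \<mu> (\<lambda>z. 1 / z ^ Suc k)"
    and inf: "\<And>F. finite F \<Longrightarrow> \<not> (AE z in \<mu>. z \<in> F)"
  shows "positive_moments (Abs_fps (\<lambda>k. (- 1) ^ k * inv_moment \<mu> (Suc k)))"
  unfolding positive_moments_def
proof (intro allI impI)
  fix p :: "real poly" assume "p \<noteq> 0"
  let ?A = "Abs_fps (\<lambda>k. (- 1) ^ k * inv_moment \<mu> (Suc k))"
  have pos: "(\<integral>z. (poly p (- 1 / z))\<^sup>2 * (1 / z ^ Suc k) \<partial>\<mu>) > 0"
    if I: "integrable \<mu> (\<lambda>z. (poly p (- 1 / z))\<^sup>2 * (1 / z ^ Suc k))" for k
  proof (rule ccontr)
    have nn: "AE z in \<mu>. 0 \<le> (poly p (- 1 / z))\<^sup>2 * (1 / z ^ Suc k)"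
      using AE_pos by eventually_elim simp
    assume "\<not> ?thesis"
    then have "(\<integral>z. (poly p (- 1 / z))\<^sup>2 * (1 / z ^ Suc k) \<partial>\<mu>) = 0"
      using integral_nonneg_AE[OF nn] by linarith
    then have "AE z in \<mu>. (poly p (- 1 / z))\<^sup>2 * (1 / z ^ Suc k) = 0"
      using integral_nonneg_eq_0_iff_AE[OF I nn] by simp
    then have "AE z in \<mu>. z \<in> (\<lambda>y. - 1 / y) ` {y. poly p y = 0}"
      using AE_pos
    proof eventually_elim
      case (elim z)
      then show ?case by (intro image_eqI[of _ _ "- 1 / z"]) auto
    qed
    then show False using inf poly_roots_finite[OF \<open>p \<noteq> 0\<close>] by blast
  qed
  have eq: "(\<lambda>z. poly (p * p) (- 1 / z) / z) = (\<lambda>z. (poly p (- 1 / z))\<^sup>2 * (1 / z ^ Suc 0))"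
    "(\<lambda>z. poly (pCons 0 (p * p)) (- 1 / z) / z) = (\<lambda>z. - ((poly p (- 1 / z))\<^sup>2 * (1 / z ^ Suc 1)))"
    by (simp_all add: power2_eq_square fun_eq_iff)
  note M = mom_inv_moment[OF int, of "p * p", unfolded eq(1)]
    and M' = mom_inv_moment[OF int, of "pCons 0 (p * p)", unfolded eq(2) integral_minus]
  have "mom ?A (p * p) > 0" using pos[OF M(2)] by (simp only: M(1))
  moreover have "mom ?A (pCons 0 (p * p)) < 0" using pos[OF Bochner_Integration.integrable_minus[OF M'(2), unfolded minus_minus]] by (simp only: M'(1) neg_less_0_iff_less)
  ultimately show "mom ?A (p * p) > 0 \<and> mom ?A (pCons 0 (p * p)) < 0" ..
qed

end

text \<open>Runs the continued fraction algorithm on series \<open>As k\<close> and functions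
  \<open>Ms k\<close> in parallel. Positivity is preserved at each step, so no constant term
  vanishes and every denominator is positive.\<close>

lemma positive_moments_cfrac:
  assumes K: "K > 0" and "positive_moments A" "\<And>N. expands N A M"
  obtains v where "\<forall>n\<ge>1. v n > 0"
    "\<forall>n. (\<lambda>x. K * x * M x - convergent_cf (K * x) v n) \<in> O[at_right 0](\<lambda>x. x ^ (n + 1))"
proof -
  define As where "As = rec_nat A (\<lambda>_ A'. fps_const (1 / K) * fps_shift 1 (inverse A'))"
  \<comment> \<open>Denominators are indexed from 1, series from 0.\<close>
  define v where "v n = 1 / fps_nth (As (n - 1)) 0" for n
  define Ms where "Ms = rec_nat M (\<lambda>k M' x. 1 / K * ((1 / M' x - v (Suc k)) / x))"
  have pos: "positive_moments (As k)" for k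
  proof (induction k)
    case 0
    then show ?case using assms(2) by (simp add: As_def)
  next
    case (Suc k)
    have "positive_moments (fps_const (1 / K) * fps_shift 1 (inverse (As k)))"
      using K by (intro positive_moments_const_mult positive_moments_shift_inverse Suc) simp
    then show ?case by (simp add: As_def)
  qed
  then have A0: "fps_nth (As k) 0 > 0" for k by (rule positive_moments_nth_0)
  have v: "v n > 0" for n using A0 by (simp add: v_def)
  have exp: "expands N (As k) (Ms k)" for N k
  proof (induction k arbitrary: N)
    case 0
    then show ?case using assms(3) by (simp add: As_def Ms_def)
  next
    case (Suc k)
    \<comment> \<open>Dividing by \<open>x\<close> costs one order, so the previous stage is used at
      order \<open>Suc N\<close>.\<close>
    have "expands (Suc N) (inverse (As k)) (\<lambda>x. 1 / Ms k x)"
      using A0[of k] by (intro expands_inverse expands_imp_tendsto[OF Suc.IH] Suc.IH) simp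
    then have "expands N (fps_shift 1 (inverse (As k))) (\<lambda>x. (1 / Ms k x - v (Suc k)) / x)"
      using A0[of k] by (simp add: v_def inverse_eq_divide)
    then show ?case
      unfolding As_def Ms_def by (simp only: nat.rec) (intro expands_mult expands_const)
  qed
  have "eventually (\<lambda>x. Ms k x * (v (Suc k) + K * x * Ms (Suc k) x) = 1) (at_right 0)" for k
  proof -
    have "eventually (\<lambda>x. Ms k x \<noteq> 0) (at_right 0)"
      using tendsto_imp_eventually_ne[OF expands_imp_tendsto[OF exp]] A0[of k] by simp
    then show ?thesis using eventually_pos_at_right_0
      by eventually_elim (use K in \<open>simp add: Ms_def\<close>)
  qed
  then have "(\<lambda>x. K * x * Ms 0 x - convergent_cf (K * x) v n) \<in> O[at_right 0](\<lambda>x. x ^ (n + 1))" for n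
    by (intro convergent_cf_error K v expands_imp_bounded[OF exp])
  then have "(\<lambda>x. K * x * M x - convergent_cf (K * x) v n) \<in> O[at_right 0](\<lambda>x. x ^ (n + 1))" for n
    by (simp only: Ms_def nat.rec)
  then show ?thesis using v by (intro that[of v] allI impI)
qed

text \<open>Clears denominators pole by pole: \<open>[:w, 1:]\<close> is the factor
  \<open>x + w\<close>.\<close>

lemma partial_fractions_rational:
  fixes c :: "real \<Rightarrow> real"
  assumes "finite F" "F \<subseteq> {0<..}"
  obtains Q P where "Q \<noteq> 0" "\<forall>x>0. (\<Sum>w\<in>F. c w / (x + w)) * poly Q x = poly P x"
proof -
  have "\<exists>P Q. Q \<noteq> 0 \<and> (\<forall>x>0. (\<Sum>w\<in>F. c w / (x + w)) * poly Q x = poly P x)"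
    using assms
  proof (induction rule: finite_induct)
    case empty
    show ?case by (intro exI[of _ 0] exI[of _ 1]) simp
  next
    case (insert w F)
    from insert.prems have "F \<subseteq> {0<..}" by simp
    from insert.IH[OF this] obtain P Q
      where PQ: "Q \<noteq> 0" "\<And>x. x > 0 \<Longrightarrow> (\<Sum>w\<in>F. c w / (x + w)) * poly Q x = poly P x"
      by (elim exE conjE) auto
    have "(\<Sum>w\<in>insert w F. c w / (x + w)) * poly (Q * [:w, 1:]) x = poly (P * [:w, 1:] + smult (c w) Q) x"
      if "x > 0" for x
    proof -
      define S where "S = (\<Sum>w\<in>F. c w / (x + w))"
      have w: "x + w \<noteq> 0" using insert.prems that by simp
      have "(\<Sum>w\<in>insert w F. c w / (x + w)) * poly (Q * [:w, 1:]) x =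
          (c w / (x + w) + S) * (poly Q x * (x + w))"
        using insert.hyps by (simp only: S_def sum.insert poly_mult) (simp add: add.commute)
      also have "\<dots> = c w * poly Q x + S * poly Q x * (x + w)"
        using w by (simp only: distrib_right[of "c w / (x + w)"]) simp
      also have "S * poly Q x = poly P x" unfolding S_def by (rule PQ(2)[OF that])
      finally show ?thesis by (simp only: poly_add poly_mult poly_smult) (simp add: add.commute)
    qed
    moreover have "Q * [:w, 1:] \<noteq> 0" using PQ(1) by (simp only: mult_eq_0_iff) simp
    ultimately show ?case
      by (intro exI[of _ "P * [:w, 1:] + smult (c w) Q"] exI[of _ "Q * [:w, 1:]"] conjI allI impI)
  qed
  then show ?thesis using that by blast
qed

text \<open>The measure is a finite sum of atoms at positive points, so its transform is a finite
  sum of simple fractions.\<close>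

lemma (in positive_support) resolvent_finite_support:
  assumes "AE z in \<mu>. z \<in> F" "finite F"
    and int: "\<And>x. x > 0 \<Longrightarrow> integrable \<mu> (\<lambda>z. 1 / (x + z))"
  obtains Q P where "Q \<noteq> 0" "\<forall>x>0. resolvent \<mu> 0 x * poly Q x = poly P x"
proof -
  define G where "G = F \<inter> {0<..}"
  have G: "finite G" "G \<subseteq> {0<..}" using assms(2) by (auto simp: G_def)
  have AE_G: "AE z in \<mu>. z \<in> G" using assms(1) AE_pos by eventually_elim (simp add: G_def)
  have res: "resolvent \<mu> 0 x = (\<Sum>w\<in>G. measure \<mu> {w} / (x + w))" if "x > 0" for x
  proof -
    have I: "integrable \<mu> (\<lambda>z. indicator {w} z * (1 / (x + z)))" for w
      using integrable_mult_indicator[OF _ int[OF that], of "{w}"] by simp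
    have atom: "(\<integral>z. indicator {w} z * (1 / (x + z)) \<partial>\<mu>) = measure \<mu> {w} / (x + w)" for w
    proof -
      have "(\<integral>z. indicator {w} z * (1 / (x + z)) \<partial>\<mu>) = (\<integral>z. indicator {w} z * (1 / (x + w)) \<partial>\<mu>)"
        by (rule Bochner_Integration.integral_cong) (auto simp: indicator_def)
      also have "\<dots> = measure \<mu> ({w} \<inter> space \<mu>) * (1 / (x + w))"
        by (subst integral_mult_left_zero) simp
      also have "{w} \<inter> space \<mu> = {w}" using sets_eq_imp_space_eq[OF sets_\<mu>] by simp
      finally show ?thesis by simp
    qed
    have "resolvent \<mu> 0 x = (\<integral>z. (\<Sum>w\<in>G. indicator {w} z * (1 / (x + z))) \<partial>\<mu>)"
      unfolding resolvent_def
    proof (rule integral_cong_AE)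
      show "AE z in \<mu>. 1 / (z ^ 0 * (x + z)) = (\<Sum>w\<in>G. indicator {w} z * (1 / (x + z)))"
        using AE_G
      proof eventually_elim
        case (elim z)
        have "(\<Sum>w\<in>G. indicator {w} z * (1 / (x + z))) = (\<Sum>w\<in>G. if w = z then 1 / (x + z) else 0)"
          by (intro sum.cong) (auto simp: indicator_def)
        then show ?case using elim G(1) by simp
      qed
    qed measurable
    also have "\<dots> = (\<Sum>w\<in>G. \<integral>z. indicator {w} z * (1 / (x + z)) \<partial>\<mu>)"
      by (rule Bochner_Integration.integral_sum) (rule I)
    also have "\<dots> = (\<Sum>w\<in>G. measure \<mu> {w} / (x + w))" by (simp only: atom)
    finally show ?thesis .
  qed
  obtain Q P where PQ: "Q \<noteq> 0"
    "\<forall>x>0. (\<Sum>w\<in>G. measure \<mu> {w} / (x + w)) * poly Q x = poly P x"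
    by (rule partial_fractions_rational[OF G, of "\<lambda>w. measure \<mu> {w}"])
  show ?thesis
  proof (rule that[OF PQ(1)], intro allI impI)
    show "resolvent \<mu> 0 x * poly Q x = poly P x" if "x > 0" for x
      unfolding res[OF that] by (rule PQ(2)[rule_format, OF that])
  qed
qed

section \<open>Supports and restriction to the positive half-line\<close>

lemma AE_support:
  assumes "sets \<sigma> = sets borel"
  shows "AE z in \<sigma>. z \<in> support \<sigma>"
proof -
  define \<F> where "\<F> = {B. open B \<and> emeasure \<sigma> B = 0}"
  \<comment> \<open>The complement of the support is a union of null open sets; Lindelof's theorem
    makes this union countable, hence null.\<close>
  obtain \<F>' where F': "\<F>' \<subseteq> \<F>" "countable \<F>'" "\<Union>\<F>' = \<Union>\<F>"
    using Lindelof[of \<F>] by (auto simp: \<F>_def)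
  have "B \<in> null_sets \<sigma>" if "B \<in> \<F>'" for B
    using that F'(1) assms by (auto simp: \<F>_def null_sets_def)
  then have "\<Union>\<F>' \<in> null_sets \<sigma>"
    using null_sets_UN'[OF F'(2), of "\<lambda>B. B" \<sigma>] by simp
  moreover have "{z \<in> space \<sigma>. z \<notin> support \<sigma>} \<subseteq> \<Union>\<F>'"
  proof
    fix z assume "z \<in> {z \<in> space \<sigma>. z \<notin> support \<sigma>}"
    then obtain e where "e > 0" "emeasure \<sigma> (ball z e) = 0"
      by (auto simp: support_def zero_less_iff_neq_zero)
    then have "ball z e \<in> \<F>" "z \<in> ball z e" by (auto simp: \<F>_def)
    then show "z \<in> \<Union>\<F>'" unfolding F'(3) by blast
  qed
  ultimately show ?thesis by (intro AE_I')
qed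

lemma support_subset_finite:
  assumes "sets \<sigma> = sets borel" "finite F" "AE z in \<sigma>. z \<in> F"
  shows "support \<sigma> \<subseteq> F"
proof
  fix z assume z: "z \<in> support \<sigma>"
  show "z \<in> F"
  proof (rule ccontr)
    assume "z \<notin> F"
    moreover have "open (- F)" using assms(2) by (simp add: finite_imp_closed open_Compl)
    ultimately obtain e where e: "e > 0" "ball z e \<subseteq> - F"
      by (meson ComplI open_contains_ball)
    have "emeasure \<sigma> (ball z e) = emeasure \<sigma> {}"
    proof (rule emeasure_eq_AE)
      show "AE y in \<sigma>. y \<in> ball z e \<longleftrightarrow> y \<in> {}"
        using assms(3) by eventually_elim (use e(2) in blast)
    qed (use assms(1) in auto)
    then show False using z e(1) by (auto simp: support_def)
  qed
qed

text \<open>Removes the atom at 0, which accounts for \<open>U(0)\<close>. A density keeps the whole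
  Borel sigma-algebra on the line.\<close>

definition pos_part :: "real measure \<Rightarrow> real measure" where
  "pos_part \<sigma> = density \<sigma> (\<lambda>z. ennreal (indicator {0<..} z))"

section \<open>Stieltjes representation of the Riccati variable\<close>

context
  fixes p :: side and U :: "real \<Rightarrow> real" and \<sigma> :: "real measure"
  assumes stieltjes: "stieltjes_measure p U \<sigma>"
begin

lemma sets_\<sigma> [measurable_cong, simp]: "sets \<sigma> = sets borel"
  using stieltjes by (simp add: stieltjes_measure_def)

lemma space_\<sigma> [simp]: "space \<sigma> = UNIV"
  using sets_eq_imp_space_eq[OF sets_\<sigma>] by simp

lemma positive_support_pos_part: "positive_support (pos_part \<sigma>)"
proof
  show "AE z in pos_part \<sigma>. 0 < z"
    unfolding pos_part_def by (subst AE_density) (auto simp: indicator_def)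
qed (simp add: pos_part_def)

lemma AE_pos_part_iff: "(AE z in pos_part \<sigma>. P z) \<longleftrightarrow> (AE z in \<sigma>. 0 < z \<longrightarrow> P z)"
  unfolding pos_part_def by (subst AE_density) (auto simp: indicator_def intro!: AE_cong)

lemma integral_pos_part:
  fixes f :: "real \<Rightarrow> real"
  shows "f \<in> borel_measurable borel \<Longrightarrow> (\<integral>z. f z \<partial>pos_part \<sigma>) = (LINT z:{0<..}|\<sigma>. f z)"
  unfolding pos_part_def set_lebesgue_integral_def by (subst integral_density) auto

lemma integrable_pos_part_iff:
  fixes f :: "real \<Rightarrow> real"
  shows "f \<in> borel_measurable borel \<Longrightarrow> integrable (pos_part \<sigma>) f \<longleftrightarrow> set_integrable \<sigma> {0<..} f"
  unfolding pos_part_def set_integrable_def by (subst integrable_density) auto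

lemma all_inverse_moments_finite_iff:
  "all_inverse_moments_finite \<sigma> \<longleftrightarrow> (\<forall>n. integrable (pos_part \<sigma>) (\<lambda>z. 1 / z ^ Suc n))"
proof -
  have "integrable (pos_part \<sigma>) (\<lambda>z. 1 / z ^ Suc n) \<longleftrightarrow> (\<integral>\<^sup>+z\<in>{0<..}. ennreal (1 / z ^ Suc n) \<partial>\<sigma>) < \<infinity>" for n
  proof -
    have "(\<integral>\<^sup>+z. ennreal (norm (indicator {0<..} z *\<^sub>R (1 / z ^ Suc n))) \<partial>\<sigma>) = (\<integral>\<^sup>+z\<in>{0<..}. ennreal (1 / z ^ Suc n) \<partial>\<sigma>)"
      by (intro nn_integral_cong) (auto simp: indicator_def)
    moreover have "(\<lambda>z. indicator {0<..} z *\<^sub>R (1 / z ^ Suc n)) \<in> borel_measurable \<sigma>" by measurable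
    moreover have "integrable (pos_part \<sigma>) (\<lambda>z. 1 / z ^ Suc n) \<longleftrightarrow> set_integrable \<sigma> {0<..} (\<lambda>z. 1 / z ^ Suc n)"
      by (rule integrable_pos_part_iff) measurable
    ultimately show ?thesis by (simp only: set_integrable_def integrable_iff_bounded simp_thms)
  qed
  moreover have "(\<forall>n\<ge>1. Q n) \<longleftrightarrow> (\<forall>n. Q (Suc n))" for Q :: "nat \<Rightarrow> bool"
    by (auto simp: Suc_le_eq gr0_conv_Suc)
  ultimately show ?thesis by (simp only: all_inverse_moments_finite_def)
qed

text \<open>Negative numbers carry no mass, so the measure and its positive part differ only by an
  atom at 0, which cannot affect finiteness.\<close>

lemma infinite_support_iff:
  "infinite (support \<sigma>) \<longleftrightarrow> (\<forall>F. finite F \<longrightarrow> \<not> (AE z in pos_part \<sigma>. z \<in> F))"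
proof (intro iffI allI impI notI)
  fix F :: "real set"
  assume inf: "infinite (support \<sigma>)" and F: "finite F" "AE z in pos_part \<sigma>. z \<in> F"
  have "AE z in \<sigma>. z \<notin> {..<0}"
    using stieltjes by (intro AE_not_in) (simp add: stieltjes_measure_def null_sets_def)
  with F(2) have "AE z in \<sigma>. z \<in> insert 0 F"
    unfolding AE_pos_part_iff by eventually_elim auto
  from support_subset_finite[OF sets_\<sigma> _ this] F(1) inf show False
    using finite_subset by blast
next
  assume *: "\<forall>F. finite F \<longrightarrow> \<not> (AE z in pos_part \<sigma>. z \<in> F)" and "finite (support \<sigma>)"
  moreover have "AE z in pos_part \<sigma>. z \<in> support \<sigma>"
    unfolding AE_pos_part_iff using AE_support[OF sets_\<sigma>] by eventually_elim simp
  ultimately show False by blast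
qed

lemma set_integrable_resolvent:
  assumes "x > 0"
  shows "set_integrable \<sigma> {0..} (\<lambda>z. 1 / (x + z))"
proof -
  have "set_integrable \<sigma> {0..} (\<lambda>z. 1 / (1 + z))"
    unfolding set_integrable_def
  proof (rule integrableI_bounded)
    have "(\<integral>\<^sup>+z. ennreal (norm (indicator {0..} z *\<^sub>R (1 / (1 + z)))) \<partial>\<sigma>) = (\<integral>\<^sup>+z\<in>{0..}. ennreal (1 / (1 + z)) \<partial>\<sigma>)"
      by (intro nn_integral_cong) (auto simp: indicator_def)
    then show "(\<integral>\<^sup>+z. ennreal (norm (indicator {0..} z *\<^sub>R (1 / (1 + z)))) \<partial>\<sigma>) < \<infinity>"
      using stieltjes by (simp add: stieltjes_measure_def)
  qed measurable
  then have I: "set_integrable \<sigma> {0..} (\<lambda>z. max 1 (1 / x) * (1 / (1 + z)))"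
    by (rule set_integrable_mult_right)
  \<comment> \<open>The constant covers both \<open>x \<ge> 1\<close> and
    \<open>x < 1\<close>.\<close>
  have "1 / (x + z) \<le> max 1 (1 / x) * (1 / (1 + z))" if "z \<ge> 0" for z
  proof -
    have "1 \<le> max 1 (1 / x) * x" using assms by (cases "x \<ge> 1") (auto simp: max_def field_simps)
    moreover have "z * 1 \<le> z * max 1 (1 / x)" using that by (intro mult_left_mono) auto
    ultimately have "1 + z \<le> max 1 (1 / x) * (x + z)" by (simp only: ring_distribs) (simp add: mult.commute)
    then show ?thesis using that assms by (simp add: divide_simps)
  qed
  then show ?thesis
    unfolding set_integrable_def using assms
    by (intro Bochner_Integration.integrable_bound[OF I[unfolded set_integrable_def]])
       (auto simp: indicator_def)
qed

lemma integrable_resolvent: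
  assumes "x > 0"
  shows "integrable (pos_part \<sigma>) (\<lambda>z. 1 / (x + z))"
  by (subst integrable_pos_part_iff) (auto intro: set_integrable_subset[OF set_integrable_resolvent[OF assms]])

lemma U_eq:
  assumes "x > 0"
  shows "U x = - sg p * 2 * (measure \<sigma> {0} + x * resolvent (pos_part \<sigma>) 0 x)"
proof -
  have "{0..} = insert (0::real) {0<..}" by auto
  then have "(LINT z:{0..}|\<sigma>. 1 / (x + z)) = (LINT z:{0} \<union> {0<..}|\<sigma>. 1 / (x + z))" by simp
  also have "\<dots> = (LINT z:{0}|\<sigma>. 1 / (x + z)) + (LINT z:{0<..}|\<sigma>. 1 / (x + z))"
    by (rule set_integral_Un) (auto intro: set_integrable_subset[OF set_integrable_resolvent[OF assms]])
  also have "(LINT z:{0}|\<sigma>. 1 / (x + z)) = (\<integral>z. indicator {0} z * (1 / x) \<partial>\<sigma>)"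
    unfolding set_lebesgue_integral_def by (rule Bochner_Integration.integral_cong) (auto simp: indicator_def)
  also have "\<dots> = measure \<sigma> {0} * (1 / x)"
    by (subst integral_mult_left_zero) simp
  also have "(LINT z:{0<..}|\<sigma>. 1 / (x + z)) = resolvent (pos_part \<sigma>) 0 x"
    by (simp add: resolvent_def integral_pos_part)
  finally have "(LINT z:{0..}|\<sigma>. 1 / (x + z)) = measure \<sigma> {0} * (1 / x) + resolvent (pos_part \<sigma>) 0 x" .
  moreover have "U x = - sg p * 2 * x * (LINT z:{0..}|\<sigma>. 1 / (x + z))"
    using stieltjes assms by (simp add: stieltjes_measure_def)
  ultimately show ?thesis using assms by (simp add: algebra_simps)
qed

text \<open>Dominated convergence: \<open>x/(x+z)\<close> tends to 0 for each \<open>z > 0\<close>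
  and is at most \<open>1/(1+z)\<close> once \<open>x \<le> 1\<close>. The substitution
  \<open>x = 1/t\<close> turns the limit at 0 into one at infinity.\<close>

lemma id_mult_resolvent_tendsto_0:
  "((\<lambda>x. x * resolvent (pos_part \<sigma>) 0 x) \<longlongrightarrow> 0) (at_right 0)"
proof -
  interpret positive_support "pos_part \<sigma>" by (rule positive_support_pos_part)
  let ?s = "\<lambda>t z. inverse t * (1 / (inverse t + z)) :: real"
  have "((\<lambda>t. \<integral>z. ?s t z \<partial>pos_part \<sigma>) \<longlongrightarrow> (\<integral>z. 0 \<partial>pos_part \<sigma>)) at_top"
  proof (rule integral_dominated_convergence_at_top)
    show "integrable (pos_part \<sigma>) (\<lambda>z. 1 / (1 + z))" by (rule integrable_resolvent) simp
    show "AE z in pos_part \<sigma>. ((\<lambda>t. ?s t z) \<longlongrightarrow> 0) at_top"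
      using AE_pos
    proof eventually_elim
      case (elim z)
      have "((\<lambda>t. ?s t z) \<longlongrightarrow> 0 * (1 / (0 + z))) at_top"
        using elim by (intro tendsto_intros tendsto_inverse_0_at_top filterlim_ident) auto
      then show ?case by simp
    qed
    show "eventually (\<lambda>t. AE z in pos_part \<sigma>. norm (?s t z) \<le> 1 / (1 + z)) at_top"
      using eventually_ge_at_top[of "1 :: real"]
    proof eventually_elim
      case (elim t)
      show ?case using AE_pos
      proof eventually_elim
        case (elim z)
        have "inverse t * (1 / (inverse t + z)) = 1 / (1 + t * z)"
          using \<open>1 \<le> t\<close> elim by (simp add: field_simps)
        moreover have "1 * z \<le> t * z" using \<open>1 \<le> t\<close> elim by (intro mult_right_mono) auto
        moreover have "norm (?s t z) = ?s t z" using \<open>1 \<le> t\<close> elim by simp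
        ultimately show ?case using elim by (simp add: frac_le)
      qed
    qed
  qed measurable
  moreover have "(\<integral>z. 0 \<partial>pos_part \<sigma>) = (0 :: real)" by simp
  ultimately show ?thesis
    unfolding filterlim_at_right_to_top resolvent_def
    by (simp only: integral_mult_right_zero power_0 mult_1)
qed

text \<open>By the previous limit, \<open>U(0)\<close> is exactly the contribution of the atom at 0,
  which cancels in the difference.\<close>

lemma U_diff:
  assumes "x > 0"
  shows "U x - Lim (at_right 0) U = - sg p * (2 * x * resolvent (pos_part \<sigma>) 0 x)"
proof -
  have ev: "eventually (\<lambda>x. - sg p * 2 * (measure \<sigma> {0} + x * resolvent (pos_part \<sigma>) 0 x) = U x) (at_right 0)"
    using eventually_pos_at_right_0 by eventually_elim (simp add: U_eq)
  have "((\<lambda>x. - sg p * 2 * (measure \<sigma> {0} + x * resolvent (pos_part \<sigma>) 0 x))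
      \<longlongrightarrow> - sg p * 2 * (measure \<sigma> {0} + 0)) (at_right 0)"
    by (intro tendsto_intros id_mult_resolvent_tendsto_0)
  then have "(U \<longlongrightarrow> - sg p * 2 * (measure \<sigma> {0} + 0)) (at_right 0)"
    by (rule Lim_transform_eventually[OF _ ev])
  then have "Lim (at_right 0) U = - sg p * 2 * (measure \<sigma> {0} + 0)"
    by (intro tendsto_Lim) auto
  then show ?thesis using U_eq[OF assms] by (simp add: algebra_simps)
qed

end

section \<open>Both implications for the Riccati variable\<close>

lemma sg_mult_self: "(- sg p) * (- sg p) = 1"
  by (cases p) auto

theorem theorem1:
  fixes D :: diffusion_data
    and \<Omega> :: "'w measure" and P :: "ereal \<Rightarrow> 'w measure"
    and X :: "real \<Rightarrow> 'w \<Rightarrow> ereal" and \<zeta> :: "'w \<Rightarrow> ereal"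
    and p :: side and x :: real
    and \<phi> :: "real \<Rightarrow> ereal \<Rightarrow> real"
    and \<sigma> :: "real measure"
  assumes "regular_diffusion D \<Omega> P X \<zeta>"
    and "riccati_admissible D p \<phi> x"
    and "stieltjes_measure p (riccati p \<phi> x) \<sigma>"
  shows "(infinite (support \<sigma>) \<and> all_inverse_moments_finite \<sigma> \<longrightarrow>
      (\<exists>u :: nat \<Rightarrow> real. (\<forall>n\<ge>1. - sg p * u n > 0) \<and>
         (\<forall>n. (\<lambda>lam. riccati p \<phi> x lam - riccati0 p \<phi> x
                  - convergent_cf (2 * lam / avar D x) u n)
               \<in> O[at_right 0](\<lambda>lam. lam ^ (n + 1)))))
    \<and> (\<forall>u :: nat \<Rightarrow> real.
         (\<forall>n\<ge>1. - sg p * u n > 0) \<and>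
         \<not> summable (\<lambda>n. u (Suc n)) \<and>
         (\<forall>lam>0. (\<lambda>n. convergent_cf (2 * lam / avar D x) u n)
                     \<longlonglongrightarrow> riccati p \<phi> x lam - riccati0 p \<phi> x)
         \<longrightarrow> infinite (support \<sigma>) \<and> all_inverse_moments_finite \<sigma>)"
proof -
  note st = assms(3)
  define \<mu> where "\<mu> = pos_part \<sigma>"
  interpret positive_support \<mu> unfolding \<mu>_def by (rule positive_support_pos_part[OF st])
  define a where "a = avar D x"
  define K where "K = 2 / a"
  \<comment> \<open>The factor \<open>a\<close> makes \<open>K * lam * M lam\<close> equal to
    \<open>2 * lam * resolvent \<mu> 0 lam\<close>, while \<open>K * lam\<close> is the partial
    numerator \<open>2 * lam / a\<close>.\<close>
  define M where "M lam = a * resolvent \<mu> 0 lam" for lam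
  define c where "c = - sg p"
  have a: "a > 0" using assms(2) by (simp add: riccati_admissible_def a_def)
  then have K: "K > 0" by (simp add: K_def)
  have cc: "c * c = 1" using sg_mult_self by (simp add: c_def)
  have U: "riccati p \<phi> x lam - riccati0 p \<phi> x = c * (K * lam * M lam)" if "lam > 0" for lam
    using U_diff[OF st that] a by (simp add: riccati0_def c_def K_def M_def \<mu>_def)
  have d: "2 * lam / avar D x = K * lam" for lam by (simp add: K_def a_def)
  show ?thesis
  proof (rule conjI; intro impI allI)
    assume "infinite (support \<sigma>) \<and> all_inverse_moments_finite \<sigma>"
    then have "\<forall>F. finite F \<longrightarrow> \<not> (AE z in \<mu>. z \<in> F)" "\<forall>n. integrable \<mu> (\<lambda>z. 1 / z ^ Suc n)"
      unfolding infinite_support_iff[OF st] all_inverse_moments_finite_iff[OF st] \<mu>_def by simp_all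
    note inf = this(1)[rule_format] and int = this(2)[rule_format]
    let ?A = "Abs_fps (\<lambda>k. (- 1) ^ k * inv_moment \<mu> (Suc k))"
    have ex: "expands N (fps_const a * ?A) M" for N
      using expands_resolvent[OF int, of N 0] unfolding M_def
      by (intro expands_mult expands_const) simp
    have "positive_moments (fps_const a * ?A)"
      using a by (intro positive_moments_const_mult positive_inv_moments int inf)
    from positive_moments_cfrac[OF K this ex] obtain v where v: "\<forall>n\<ge>1. v n > 0"
      "\<forall>n. (\<lambda>x. K * x * M x - convergent_cf (K * x) v n) \<in> O[at_right 0](\<lambda>x. x ^ (n + 1))"
      .
    define u where "u n = c * v n" for n
    have "- sg p * u n > 0" if "n \<ge> 1" for n
    proof -
      have "- sg p * u n = (c * c) * v n" by (simp add: u_def c_def)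
      then show ?thesis using cc v(1) that by simp
    qed
    moreover have "(\<lambda>lam. riccati p \<phi> x lam - riccati0 p \<phi> x - convergent_cf (2 * lam / avar D x) u n)
        \<in> O[at_right 0](\<lambda>lam. lam ^ (n + 1))" for n
    proof -
      have ev: "eventually (\<lambda>lam. c * (K * lam * M lam - convergent_cf (K * lam) v n) =
          riccati p \<phi> x lam - riccati0 p \<phi> x - convergent_cf (2 * lam / avar D x) u n) (at_right 0)"
        using eventually_pos_at_right_0
        by eventually_elim (simp add: U d u_def[abs_def] convergent_cf_scale[OF cc] right_diff_distrib del: of_nat_Suc)
      have "(\<lambda>lam. c * (K * lam * M lam - convergent_cf (K * lam) v n)) \<in> O[at_right 0](\<lambda>lam. 1 * lam ^ (n + 1))"
        by (intro landau_o.big.mult v(2)[rule_format]) simp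
      then show ?thesis using landau_o.big.in_cong[OF ev] by simp
    qed
    ultimately show "\<exists>u :: nat \<Rightarrow> real. (\<forall>n\<ge>1. - sg p * u n > 0) \<and>
         (\<forall>n. (\<lambda>lam. riccati p \<phi> x lam - riccati0 p \<phi> x
                  - convergent_cf (2 * lam / avar D x) u n)
               \<in> O[at_right 0](\<lambda>lam. lam ^ (n + 1)))" by (intro exI[of _ u] conjI allI impI)
  next
    fix u :: "nat \<Rightarrow> real"
    assume u: "(\<forall>n\<ge>1. - sg p * u n > 0) \<and> \<not> summable (\<lambda>n. u (Suc n)) \<and>
         (\<forall>lam>0. (\<lambda>n. convergent_cf (2 * lam / avar D x) u n)
                     \<longlonglongrightarrow> riccati p \<phi> x lam - riccati0 p \<phi> x)"
    define v where "v n = c * u n" for n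
    have cf: "has_cf K v M"
      unfolding has_cf_def
    proof (intro conjI allI impI)
      fix n :: nat assume "1 \<le> n"
      then show "v n > 0" using u by (simp add: v_def c_def)
    next
      fix lam :: real assume lam: "lam > 0"
      then have "(\<lambda>n. convergent_cf (2 * lam / avar D x) u n) \<longlonglongrightarrow> riccati p \<phi> x lam - riccati0 p \<phi> x"
        using u by blast
      then have "(\<lambda>n. convergent_cf (K * lam) u n) \<longlonglongrightarrow> c * (K * lam * M lam)"
        by (simp only: U[OF lam] d)
      \<comment> \<open>Since \<open>c * c = 1\<close>, multiplying by \<open>c\<close> removes the
        sign from the limit and turns the denominators \<open>u\<close> into
        \<open>v\<close>.\<close>
      then have "(\<lambda>n. c * convergent_cf (K * lam) u n) \<longlonglongrightarrow> c * (c * (K * lam * M lam))"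
        by (intro tendsto_intros)
      also have "c * (c * (K * lam * M lam)) = K * lam * M lam" using cc by (simp flip: mult.assoc)
      finally show "(\<lambda>n. convergent_cf (K * lam) v n) \<longlonglongrightarrow> K * lam * M lam"
        unfolding v_def[abs_def] by (simp add: convergent_cf_scale[OF cc])
    qed
    have int: "integrable \<mu> (\<lambda>z. 1 / (lam + z))" if "lam > 0" for lam
      unfolding \<mu>_def by (rule integrable_resolvent[OF st that])
    have "\<exists>A. expands N A (resolvent \<mu> 0)" for N
    proof -
      obtain A where "expands N A M" using has_cf_expands[OF K cf] by blast
      then have "expands N (fps_const (1 / a) * A) (\<lambda>lam. 1 / a * M lam)"
        by (intro expands_mult expands_const)
      moreover have "(\<lambda>lam. 1 / a * M lam) = resolvent \<mu> 0" using a by (simp add: M_def)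
      ultimately show ?thesis by auto
    qed
    then have "integrable \<mu> (\<lambda>z. 1 / z ^ Suc n)" for n
      using int by (rule expands_imp_moments)
    then have "all_inverse_moments_finite \<sigma>"
      unfolding all_inverse_moments_finite_iff[OF st] \<mu>_def by blast
    moreover have "infinite (support \<sigma>)"
      unfolding infinite_support_iff[OF st] \<mu>_def[symmetric]
    proof (intro allI impI notI)
      \<comment> \<open>A finite carrier would make \<open>M\<close> rational, which no infinite
        continued fraction of this kind allows.\<close>
      fix F assume "finite F" "AE z in \<mu>. z \<in> F"
      from resolvent_finite_support[OF this(2,1) int]
      obtain Q P where PQ: "Q \<noteq> 0" "\<forall>x>0. resolvent \<mu> 0 x * poly Q x = poly P x" .
      show False
      proof (rule has_cf_not_rational[OF K cf PQ(1)])
        show "M x * poly Q x = poly (smult a P) x" if "x > 0" for x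
          using PQ(2)[rule_format, OF that] by (simp add: M_def)
      qed
    qed
    ultimately show "infinite (support \<sigma>) \<and> all_inverse_moments_finite \<sigma>" by simp
  qed
qed

end
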